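(* There exist a nonempty Baire space $E$, a nonempty compact space $K$, and a separately continuous function $e:E\times K\to\{0,1\}$ such that for every non-meager Borel set $B\subseteq E\times K$ the restriction $e|_B:B\to\{0,1\}$ is not continuous.
   Context: All spaces are completely regular (Hausdorff) topological spaces. A space $E$ is Baire if any intersection of countably many open dense subsets of $E$ is dense in $E$. The set $\{0,1\}$ carries the discrete topology, $E\times K$ carries the product topology, and $B$ carries the subspace topology. "Non-meager" means not a countable union of nowhere dense subsets of $E\times K$; "Borel" refers to the $\sigma$-algebra generated by the open subsets of $E\times K$. A function $e:E\times K\to\{0,1\}$ is separately continuous if for every $t\in E$ the function $x\mapsto e(t,x)$ is continuous on $K$, and for every $x\in K$ the function $t\mapsto e(t,x)$ is continuous on $E$. *)

theory Defs
  imports "HOL-Analysis.Analysis"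
begin

text \<open>
  HOL has no quantifier over types, so ``there exists a space'' needs a fixed type of points, of
  which the carrier of the space is an arbitrary subset. The type below has cardinality
  \<open>beth_6\<close>; every topological space with at most that many points is homeomorphic to one whose
  carrier lies in it. The points carry no structure.
\<close>

type_synonym point = "nat set set set set set set"

definition tychonoff_space :: "'a topology \<Rightarrow> bool" where
  "tychonoff_space X \<longleftrightarrow> completely_regular_space X \<and> Hausdorff_space X"

text \<open>The intersection with \<^term>\<open>topspace X\<close> only matters for the empty family, where
  \<^term>\<open>\<Inter>{}\<close> is \<^term>\<open>UNIV\<close>.\<close>

definition Baire_space :: "'a topology \<Rightarrow> bool" where
  "Baire_space X \<longleftrightarrow>
    (\<forall>\<G>. countable \<G> \<and> (\<forall>U\<in>\<G>. openin X U \<and> X closure_of U = topspace X)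
         \<longrightarrow> X closure_of (topspace X \<inter> \<Inter>\<G>) = topspace X)"

definition nowhere_dense_in :: "'a topology \<Rightarrow> 'a set \<Rightarrow> bool" where
  "nowhere_dense_in X S \<longleftrightarrow> S \<subseteq> topspace X \<and> X interior_of (X closure_of S) = {}"

definition meager_in :: "'a topology \<Rightarrow> 'a set \<Rightarrow> bool" where
  "meager_in X S \<longleftrightarrow> (\<exists>\<N>. countable \<N> \<and> (\<forall>N\<in>\<N>. nowhere_dense_in X N) \<and> S = \<Union>\<N>)"

definition borel_sets_of :: "'a topology \<Rightarrow> 'a set set" where
  "borel_sets_of X = sigma_sets (topspace X) {U. openin X U}"

abbreviation two_point :: "nat topology" where
  "two_point \<equiv> discrete_topology {0, 1}"

definition separately_continuous ::
    "'a topology \<Rightarrow> 'b topology \<Rightarrow> 'c topology \<Rightarrow> ('a \<times> 'b \<Rightarrow> 'c) \<Rightarrow> bool" where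
  "separately_continuous X Y Z f \<longleftrightarrow>
    (\<forall>t\<in>topspace X. continuous_map Y Z (\<lambda>x. f (t, x))) \<and>
    (\<forall>x\<in>topspace Y. continuous_map X Z (\<lambda>t. f (t, x)))"

end

theory Submission
  imports Defs "HOL-Library.Countable_Set_Type"
begin

text \<open>
  Let \<open>K\<close> be a compact zero-dimensional space in which disjoint countable unions of clopen sets can
  be separated by a clopen set, and which is covered by nowhere dense closed P-sets. Let \<open>E\<close> be the
  set of clopen subsets of \<open>K\<close>, where a neighbourhood of \<open>A\<close> consists of all clopen sets with the
  same trace as \<open>A\<close> on a given nowhere dense closed P-set, and let \<open>e(A, x) = 1\<close> iff \<open>x \<in> A\<close>.
  If the traces of \<open>A\<^sub>n\<close> on P-sets \<open>Z\<^sub>n\<close> cohere, then they already cohere on neighbourhoods of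
  the \<open>Z\<^sub>n\<close>, hence come from one clopen set. Therefore a countable intersection of dense open
  subsets of \<open>E \<times> K\<close> meets every open box in points with \<open>e = 0\<close> and in points with \<open>e = 1\<close>. As
  Borel sets have the Baire property, this rules out continuity on non-meager Borel sets.

  For \<open>K\<close> take the ultrafilters on the set of functions \<open>y : \<omega>\<^sub>2 \<rightarrow> \<omega>\<^sub>1 + 1\<close> satisfying
  \<open>h(i, j) \<le> max (y i) (y j)\<close> for \<open>i < j\<close>, with \<open>h(\<cdot>, j)\<close> injective into \<open>\<omega>\<^sub>1\<close>, that avoid the
  \<open>\<omega>\<^sub>2\<close>-complete ideal generated by the sets \<open>{y. y i = \<omega>\<^sub>1}\<close>. The P-set \<open>Z\<^sub>i\<close> consists of the
  ultrafilters along which \<open>y i\<close> tends to \<open>\<omega>\<^sub>1\<close>. If an ultrafilter were in no \<open>Z\<^sub>i\<close>, then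
  \<open>y i \<le> a\<close> would hold almost surely for one \<open>a < \<omega>\<^sub>1\<close> and \<open>\<omega>\<^sub>2\<close> many \<open>i\<close>, which contradicts
  the constraint.
\<close>

section \<open>Meager sets and the Baire property\<close>

lemma meager_in_subset:
  assumes "meager_in X S" "T \<subseteq> S"
  shows "meager_in X T"
proof -
  obtain \<N> where \<N>: "countable \<N>" "\<forall>N\<in>\<N>. nowhere_dense_in X N" "S = \<Union>\<N>"
    using assms(1) unfolding meager_in_def by blast
  have "nowhere_dense_in X (N \<inter> T)" if "N \<in> \<N>" for N
  proof -
    have "X interior_of (X closure_of (N \<inter> T)) \<subseteq> X interior_of (X closure_of N)"
      by (intro interior_of_mono closure_of_mono) auto
    then show ?thesis using \<N>(2) that unfolding nowhere_dense_in_def by blast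
  qed
  moreover have "T = \<Union>((\<lambda>N. N \<inter> T) ` \<N>)" using \<N>(3) assms(2) by auto
  ultimately show ?thesis
    unfolding meager_in_def using \<N>(1)
    by (intro exI[of _ "(\<lambda>N. N \<inter> T) ` \<N>"]) auto
qed

lemma meager_in_Union:
  assumes "countable \<S>" "\<And>S. S \<in> \<S> \<Longrightarrow> meager_in X S"
  shows "meager_in X (\<Union>\<S>)"
proof -
  obtain \<N> where \<N>: "\<And>S. S \<in> \<S> \<Longrightarrow>
      countable (\<N> S) \<and> (\<forall>N\<in>\<N> S. nowhere_dense_in X N) \<and> S = \<Union>(\<N> S)"
    using assms(2) unfolding meager_in_def by metis
  show ?thesis unfolding meager_in_def
    using \<N> assms(1) by (intro exI[of _ "\<Union>S\<in>\<S>. \<N> S"]) fastforce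
qed

lemma meager_in_Un: "meager_in X S \<Longrightarrow> meager_in X T \<Longrightarrow> meager_in X (S \<union> T)"
  using meager_in_Union[of "{S, T}" X] by auto

lemma meager_in_empty: "meager_in X {}"
  unfolding meager_in_def by (intro exI[of _ "{}"]) auto

text \<open>The difference is closed, and an open subset of it lies in \<open>C\<close>, hence in
  the interior that was removed.\<close>

lemma meager_in_frontier_closed:
  assumes "closedin X C"
  shows "meager_in X (C - X interior_of C)"
proof -
  have "closedin X (C - X interior_of C)"
    using assms by (simp add: closedin_diff)
  moreover have "X interior_of (C - X interior_of C) = {}"
  proof -
    have "X interior_of (C - X interior_of C) \<subseteq> X interior_of C"
      by (intro interior_of_mono) auto
    then show ?thesis using interior_of_subset[of X "C - X interior_of C"] by auto
  qed
  ultimately have "nowhere_dense_in X (C - X interior_of C)"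
    unfolding nowhere_dense_in_def by (simp add: closure_of_closedin closedin_subset)
  then show ?thesis
    unfolding meager_in_def by (intro exI[of _ "{C - X interior_of C}"]) auto
qed

lemma dense_complement_closure:
  assumes "nowhere_dense_in X N"
  shows "openin X (topspace X - X closure_of N)"
    and "X closure_of (topspace X - X closure_of N) = topspace X"
  using assms unfolding nowhere_dense_in_def by (auto simp add: closure_of_complement openin_diff)

text \<open>Sets that differ from an open set by meager sets form a sigma-algebra containing the
  open sets.\<close>

lemma borel_sets_of_Baire_property:
  assumes "B \<in> borel_sets_of X"
  obtains U where "openin X U" "meager_in X (B - U)" "meager_in X (U - B)"
proof -
  have "\<exists>U. openin X U \<and> meager_in X (B - U) \<and> meager_in X (U - B)"
    using assms unfolding borel_sets_of_def
  proof (induction rule: sigma_sets.induct)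
    case (Basic a)
    then show ?case using meager_in_empty by (intro exI[of _ a]) auto
  next
    case Empty
    then show ?case using meager_in_empty by (intro exI[of _ "{}"]) auto
  next
    case (Compl a)
    then obtain U where U: "openin X U" "meager_in X (a - U)" "meager_in X (U - a)" by blast
    \<comment> \<open>The complement of \<open>U\<close> is closed; passing to its interior costs
      only a meager frontier.\<close>
    let ?C = "topspace X - U"
    let ?V = "X interior_of ?C"
    have "meager_in X ((topspace X - a) - ?V)"
      by (rule meager_in_subset[OF meager_in_Un[OF U(3) meager_in_frontier_closed[of X ?C]]])
        (use U(1) in auto)
    moreover have "meager_in X (?V - (topspace X - a))"
      by (rule meager_in_subset[OF U(2)]) (use interior_of_subset[of X ?C] in auto)
    ultimately show ?case by (intro exI[of _ ?V]) auto
  next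
    case (Union a)
    then obtain U where U: "\<And>i::nat. openin X (U i) \<and> meager_in X (a i - U i) \<and> meager_in X (U i - a i)"
      by metis
    have 1: "meager_in X (\<Union>i. a i - U i)" and 2: "meager_in X (\<Union>i. U i - a i)"
      using U by (auto intro!: meager_in_Union)
    have "meager_in X ((\<Union>i. a i) - (\<Union>i. U i))" by (rule meager_in_subset[OF 1]) auto
    moreover have "meager_in X ((\<Union>i. U i) - (\<Union>i. a i))" by (rule meager_in_subset[OF 2]) auto
    moreover have "openin X (\<Union>i. U i)" using U by auto
    ultimately show ?case by blast
  qed
  then show thesis using that by blast
qed

lemma zero_dim_imp_completely_regular_space:
  assumes "\<And>U x. openin X U \<Longrightarrow> x \<in> U \<Longrightarrow> \<exists>W. openin X W \<and> closedin X W \<and> x \<in> W \<and> W \<subseteq> U"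
  shows "completely_regular_space X"
  unfolding completely_regular_space_def
proof (intro allI impI)
  fix S x assume "closedin X S \<and> x \<in> topspace X - S"
  then obtain W where W: "openin X W" "closedin X W" "x \<in> W" "W \<subseteq> topspace X - S"
    using assms[of "topspace X - S" x] by auto
  let ?f = "\<lambda>y. if y \<in> W then 0 else 1 :: real"
  have "continuous_map X (top_of_set {0..1}) ?f"
    unfolding continuous_map_in_subtopology
  proof (intro conjI)
    have "openin X {y \<in> topspace X. ?f y \<in> U}" for U
    proof -
      have "{y \<in> topspace X. ?f y \<in> U} =
          (if 0 \<in> U then W else {}) \<union> (if 1 \<in> U then topspace X - W else {})"
        using openin_subset[OF W(1)] by auto
      moreover have "openin X (topspace X - W)" using W(2) by blast
      ultimately show ?thesis using W(1) by auto
    qed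
    then show "continuous_map X euclideanreal ?f" unfolding continuous_map_def by auto
  qed auto
  then show "\<exists>f. continuous_map X (top_of_set {0..1::real}) f \<and> f x = 0 \<and> f ` S \<subseteq> {1}"
    using W by (intro exI[of _ ?f]) auto
qed

section \<open>Spaces covered by nowhere dense P-sets\<close>

text \<open>The last clause is the P-set condition: countable intersections of neighbourhoods of
  \<open>Z\<close> are again neighbourhoods of \<open>Z\<close>.\<close>

definition nd_P_set :: "'a topology \<Rightarrow> 'a set \<Rightarrow> bool" where
  "nd_P_set X Z \<longleftrightarrow> closedin X Z \<and> X interior_of Z = {} \<and>
    (\<forall>U::nat \<Rightarrow> 'a set. (\<forall>n. openin X (U n) \<and> Z \<subseteq> U n) \<longrightarrow>
       (\<exists>V. openin X V \<and> Z \<subseteq> V \<and> (\<forall>n. V \<subseteq> U n)))"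

lemma nd_P_set_empty: "nd_P_set X {}"
  unfolding nd_P_set_def by auto

text \<open>Closure under unions lets two basic neighbourhoods in the space \<open>E\<close> below
  be refined by a third.\<close>

lemma nd_P_set_Un:
  assumes "nd_P_set X Y" "nd_P_set X Z"
  shows "nd_P_set X (Y \<union> Z)"
  unfolding nd_P_set_def
proof (intro conjI allI impI)
  show "closedin X (Y \<union> Z)" using assms unfolding nd_P_set_def by auto
  show "X interior_of (Y \<union> Z) = {}"
    using assms unfolding nd_P_set_def
    by (metis interior_of_union_eq_empty)
next
  fix U :: "nat \<Rightarrow> 'a set" assume U: "\<forall>n. openin X (U n) \<and> Y \<union> Z \<subseteq> U n"
  then have "\<exists>V. openin X V \<and> Y \<subseteq> V \<and> (\<forall>n. V \<subseteq> U n)"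
    using assms(1) unfolding nd_P_set_def by simp
  moreover have "\<exists>V. openin X V \<and> Z \<subseteq> V \<and> (\<forall>n. V \<subseteq> U n)"
    using U assms(2) unfolding nd_P_set_def by simp
  ultimately obtain V W where "openin X V" "Y \<subseteq> V" "\<forall>n. V \<subseteq> U n"
     "openin X W" "Z \<subseteq> W" "\<forall>n. W \<subseteq> U n" by blast
  then show "\<exists>V. openin X V \<and> Y \<union> Z \<subseteq> V \<and> (\<forall>n. V \<subseteq> U n)"
    by (intro exI[of _ "V \<union> W"]) auto
qed

definition clopenin :: "'a topology \<Rightarrow> 'a set \<Rightarrow> bool" where
  "clopenin X A \<longleftrightarrow> openin X A \<and> closedin X A"

lemma clopenin_simps [simp, intro]:
  "clopenin X {}" "clopenin X (topspace X)"
  "clopenin X A \<Longrightarrow> clopenin X B \<Longrightarrow> clopenin X (A \<union> B)"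
  "clopenin X A \<Longrightarrow> clopenin X B \<Longrightarrow> clopenin X (A \<inter> B)"
  "clopenin X A \<Longrightarrow> clopenin X B \<Longrightarrow> clopenin X (A - B)"
  unfolding clopenin_def by (auto simp: openin_diff closedin_diff)

text \<open>\<open>separation\<close> is the countable separation property of the algebra of clopen
  sets. The bijection \<open>\<phi>\<close> names clopen sets by elements of an arbitrary type, so
  that the points of \<open>E\<close> can later be chosen in the type \<open>point\<close>.\<close>

locale nd_P_covered =
  fixes K :: "'a topology" and T :: "'b set" and \<phi> :: "'b \<Rightarrow> 'a set"
  assumes compact: "compact_space K" and Hausdorff: "Hausdorff_space K"
    and nonempty: "topspace K \<noteq> {}"
    and zero_dim: "\<And>U x. openin K U \<Longrightarrow> x \<in> U \<Longrightarrow> \<exists>W. clopenin K W \<and> x \<in> W \<and> W \<subseteq> U"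
    and separation: "\<And>P Q :: nat \<Rightarrow> 'a set.
      \<lbrakk>\<And>n. clopenin K (P n); \<And>n. clopenin K (Q n); \<And>m n. P m \<inter> Q n = {}\<rbrakk>
      \<Longrightarrow> \<exists>A. clopenin K A \<and> (\<forall>n. P n \<subseteq> A \<and> Q n \<inter> A = {})"
    and cover: "\<And>x. x \<in> topspace K \<Longrightarrow> \<exists>Z. nd_P_set K Z \<and> x \<in> Z"
    and \<phi>: "bij_betw \<phi> T {A. clopenin K A}"
begin

section \<open>The space of clopen sets, topologized by traces on P-sets\<close>

definition cyl :: "'b \<Rightarrow> 'a set \<Rightarrow> 'b set" where
  "cyl t Z = {s \<in> T. \<phi> s \<inter> Z = \<phi> t \<inter> Z}"

definition E :: "'b topology" where
  "E = topology (\<lambda>U. U \<subseteq> T \<and> (\<forall>t\<in>U. \<exists>Z. nd_P_set K Z \<and> cyl t Z \<subseteq> U))"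

lemma openin_E: "openin E U \<longleftrightarrow> U \<subseteq> T \<and> (\<forall>t\<in>U. \<exists>Z. nd_P_set K Z \<and> cyl t Z \<subseteq> U)"
proof -
  have "istopology (\<lambda>U. U \<subseteq> T \<and> (\<forall>t\<in>U. \<exists>Z. nd_P_set K Z \<and> cyl t Z \<subseteq> U))"
    unfolding istopology_def
  proof (intro conjI allI impI)
    fix U V
    assume UV: "U \<subseteq> T \<and> (\<forall>t\<in>U. \<exists>Z. nd_P_set K Z \<and> cyl t Z \<subseteq> U)"
      "V \<subseteq> T \<and> (\<forall>t\<in>V. \<exists>Z. nd_P_set K Z \<and> cyl t Z \<subseteq> V)"
    show "U \<inter> V \<subseteq> T" using UV by auto
    show "\<forall>t\<in>U \<inter> V. \<exists>Z. nd_P_set K Z \<and> cyl t Z \<subseteq> U \<inter> V"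
    proof
      fix t assume "t \<in> U \<inter> V"
      then obtain Y Z where "nd_P_set K Y" "cyl t Y \<subseteq> U" "nd_P_set K Z" "cyl t Z \<subseteq> V"
        using UV by blast
      moreover have "cyl t (Y \<union> Z) \<subseteq> cyl t Y \<inter> cyl t Z" unfolding cyl_def by auto
      ultimately show "\<exists>Z. nd_P_set K Z \<and> cyl t Z \<subseteq> U \<inter> V"
        using nd_P_set_Un by (intro exI[of _ "Y \<union> Z"]) blast
    qed
  next
    fix \<K> assume *: "\<forall>U\<in>\<K>. U \<subseteq> T \<and> (\<forall>t\<in>U. \<exists>Z. nd_P_set K Z \<and> cyl t Z \<subseteq> U)"
    then show "\<Union>\<K> \<subseteq> T" by auto
    show "\<forall>t\<in>\<Union>\<K>. \<exists>Z. nd_P_set K Z \<and> cyl t Z \<subseteq> \<Union>\<K>"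
      using * by (meson Union_iff Union_upper subset_trans)
  qed
  then show ?thesis unfolding E_def by (simp add: topology_inverse')
qed

lemma topspace_E: "topspace E = T"
proof -
  have "openin E T"
    unfolding openin_E using nd_P_set_empty by (force simp: cyl_def)
  then show ?thesis using openin_subset openin_E by (metis openin_topspace subset_antisym)
qed

lemma clopenin_\<phi>: "t \<in> T \<Longrightarrow> clopenin K (\<phi> t)"
  using \<phi> by (auto dest: bij_betw_apply)

lemma \<phi>_surj: "clopenin K A \<Longrightarrow> \<exists>t\<in>T. \<phi> t = A"
  using bij_betw_imp_surj_on[OF \<phi>] by (metis (mono_tags, lifting) image_iff mem_Collect_eq)

lemma \<phi>_inj: "s \<in> T \<Longrightarrow> t \<in> T \<Longrightarrow> \<phi> s = \<phi> t \<Longrightarrow> s = t"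
  using bij_betw_imp_inj_on[OF \<phi>] by (meson inj_onD)

lemma \<phi>_subset: "t \<in> T \<Longrightarrow> \<phi> t \<subseteq> topspace K"
  using clopenin_\<phi> unfolding clopenin_def by (meson openin_subset)

lemma openin_cyl: "nd_P_set K Z \<Longrightarrow> openin E (cyl t Z)"
  unfolding openin_E by (auto simp: cyl_def intro!: exI[of _ Z])

text \<open>For fixed \<open>Z\<close> the cylinders partition \<open>T\<close>, so the complement
  of one is a union of others.\<close>

lemma closedin_cyl:
  assumes "nd_P_set K Z"
  shows "closedin E (cyl t Z)"
proof -
  have "openin E (T - cyl t Z)"
    unfolding openin_E using assms by (auto simp: cyl_def intro!: exI[of _ Z])
  then show ?thesis unfolding closedin_def topspace_E by (auto simp: cyl_def)
qed

text \<open>Some nowhere dense P-set \<open>Z\<close> contains \<open>x\<close>, and the trace of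
  \<open>\<phi> t\<close> on \<open>Z\<close> decides whether \<open>x\<close> is in
  \<open>\<phi> t\<close>.\<close>

lemma openin_section:
  assumes "x \<in> topspace K"
  shows "openin E {t \<in> T. x \<in> \<phi> t \<longleftrightarrow> c}"
proof -
  obtain Z where "nd_P_set K Z" "x \<in> Z" using cover assms by blast
  then show ?thesis
    unfolding openin_E by (auto simp: cyl_def intro!: exI[of _ Z])
qed

lemma tychonoff_E: "tychonoff_space E"
  unfolding tychonoff_space_def
proof
  show "completely_regular_space E"
  proof (rule zero_dim_imp_completely_regular_space)
    fix U x assume "openin E U" "x \<in> U"
    then obtain Z where "nd_P_set K Z" "cyl x Z \<subseteq> U" and "x \<in> T"
      using openin_E by (metis subsetD)
    moreover from this have "x \<in> cyl x Z" unfolding cyl_def by simp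
    ultimately show "\<exists>W. openin E W \<and> closedin E W \<and> x \<in> W \<and> W \<subseteq> U"
      using openin_cyl[of Z x] closedin_cyl[of Z x] by (intro exI[of _ "cyl x Z"]) simp
  qed
  show "Hausdorff_space E"
    unfolding Hausdorff_space_def topspace_E
  proof (intro allI impI)
    fix s t assume st: "s \<in> T \<and> t \<in> T \<and> s \<noteq> t"
    then obtain x where x: "x \<in> topspace K" "x \<in> \<phi> s \<longleftrightarrow> x \<notin> \<phi> t"
      using \<phi>_inj \<phi>_subset by blast
    show "\<exists>U V. openin E U \<and> openin E V \<and> s \<in> U \<and> t \<in> V \<and> disjnt U V"
      using st x openin_section[OF x(1), of "x \<in> \<phi> s"] openin_section[OF x(1), of "x \<in> \<phi> t"]
      by (intro exI[of _ "{u \<in> T. x \<in> \<phi> u \<longleftrightarrow> x \<in> \<phi> s}"] exI[of _ "{u \<in> T. x \<in> \<phi> u \<longleftrightarrow> x \<in> \<phi> t}"])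
        (auto simp: disjnt_def)
  qed
qed

lemma tychonoff_K: "tychonoff_space K"
  unfolding tychonoff_space_def
  using Hausdorff zero_dim clopenin_def by (metis zero_dim_imp_completely_regular_space)

text \<open>Since \<open>Z n\<close> is a P-set, all \<open>A m\<close> with \<open>m \<ge> n\<close> agree on one neighbourhood \<open>V\<close> of \<open>Z n\<close>.\<close>

lemma coherent_extension:
  assumes A: "\<And>n. clopenin K (A n)" and Z: "\<And>n. nd_P_set K (Z n)"
    and coh: "\<And>m n. n \<le> m \<Longrightarrow> A m \<inter> Z n = A n \<inter> Z n"
  shows "\<exists>B. clopenin K B \<and> (\<forall>n::nat. B \<inter> Z n = A n \<inter> Z n)"
proof -
  have "\<exists>V. clopenin K V \<and> Z n \<subseteq> V \<and> (\<forall>m\<ge>n. A m \<inter> V = A n \<inter> V)" for n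
  proof -
    \<comment> \<open>\<open>U m\<close> consists of the points at which \<open>A (n + m)\<close>
      and \<open>A n\<close> agree.\<close>
    define U where "U m = topspace K - (A (n + m) - A n) - (A n - A (n + m))" for m
    have Zn: "closedin K (Z n)" using Z unfolding nd_P_set_def by blast
    have "openin K (U m) \<and> Z n \<subseteq> U m" for m
    proof
      have "clopenin K (U m)" unfolding U_def using A by (intro clopenin_simps)
      then show "openin K (U m)" unfolding clopenin_def by blast
      show "Z n \<subseteq> U m"
        using coh[of n "n + m"] closedin_subset[OF Zn] unfolding U_def set_eq_iff by auto
    qed
    then obtain V where V: "openin K V" "Z n \<subseteq> V" "\<forall>m. V \<subseteq> U m"
      using Z[of n] unfolding nd_P_set_def by blast
    \<comment> \<open>Compactness of \<open>Z n\<close> shrinks the neighbourhood \<open>V\<close>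
      to a clopen one.\<close>
    have "compactin K (Z n)" using Zn compact closedin_compact_space by blast
    moreover obtain W where W: "\<And>x. x \<in> V \<Longrightarrow> clopenin K (W x) \<and> x \<in> W x \<and> W x \<subseteq> V"
      using zero_dim[OF V(1)] by metis
    moreover have "\<forall>U\<in>W ` Z n. openin K U" "Z n \<subseteq> \<Union>(W ` Z n)"
      using V(2) W unfolding clopenin_def by blast+
    ultimately obtain \<F> where \<F>: "finite \<F>" "\<F> \<subseteq> W ` Z n" "Z n \<subseteq> \<Union>\<F>"
      unfolding compactin_def by metis
    have "clopenin K (\<Union>\<F>)"
      using \<F>(1,2) V(2) W unfolding clopenin_def by (intro conjI openin_Union closedin_Union) blast+
    moreover have "\<Union>\<F> \<subseteq> V" using \<F>(2) V(2) W by blast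
    moreover have "A m \<inter> V = A n \<inter> V" if "n \<le> m" for m
      using V(3)[rule_format, of "m - n"] that unfolding U_def by auto
    ultimately show ?thesis using \<F>(3) by (intro exI[of _ "\<Union>\<F>"]) blast
  qed
  then obtain V where V: "\<And>n. clopenin K (V n) \<and> Z n \<subseteq> V n \<and> (\<forall>m\<ge>n. A m \<inter> V n = A n \<inter> V n)"
    by metis
  \<comment> \<open>The set with the larger index agrees with \<open>A m\<close> on
    \<open>V m\<close> and with \<open>A n\<close> on \<open>V n\<close>. A clopen \<open>B\<close>
    separating the two families then equals \<open>A n\<close> on \<open>V n\<close>.\<close>
  have "V m \<inter> A m \<inter> (V n - A n) = {}" for m n
    using V[of m] V[of n] by (cases "m \<le> n") (auto simp: set_eq_iff, metis nle_le)
  then obtain B where "clopenin K B" "\<forall>n. V n \<inter> A n \<subseteq> B \<and> (V n - A n) \<inter> B = {}"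
    using separation[of "\<lambda>n. V n \<inter> A n" "\<lambda>n. V n - A n"] V A by auto
  then show ?thesis using V by (intro exI[of _ B]) blast
qed

section \<open>Fusion of boxes in the product of \<open>E\<close> and \<open>K\<close>\<close>

lemma box_in_open:
  assumes "openin (prod_topology E K) R" "(t, x) \<in> R"
  obtains Z W where "nd_P_set K Z" "clopenin K W" "x \<in> W" "cyl t Z \<times> W \<subseteq> R"
proof -
  obtain U V where UV: "openin E U" "openin K V" "t \<in> U" "x \<in> V" "U \<times> V \<subseteq> R"
    using assms(1)[unfolded openin_prod_topology_alt, rule_format, OF assms(2)]
    by (elim exE conjE)
  obtain Z where "nd_P_set K Z" "cyl t Z \<subseteq> U" using UV(1,3) openin_E by metis
  moreover obtain W where "clopenin K W" "x \<in> W" "W \<subseteq> V" using zero_dim[OF UV(2,4)] by blast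
  moreover have "cyl t Z \<times> W \<subseteq> R" using UV(5) \<open>cyl t Z \<subseteq> U\<close> \<open>W \<subseteq> V\<close> by blast
  ultimately show thesis using that by metis
qed

text \<open>\<open>Z\<close> has empty interior, so \<open>W\<close> has a point \<open>z\<close>
  outside it. Changing \<open>\<phi> t\<close> on a clopen neighbourhood of \<open>z\<close> that
  misses \<open>Z\<close> keeps the trace on \<open>Z\<close> and gives \<open>z\<close> either
  value; enlarging \<open>Z\<close> by a P-set through \<open>z\<close> freezes that value.\<close>

lemma decide_point:
  assumes "t \<in> T" "nd_P_set K Z" "clopenin K W" "W \<noteq> {}"
  obtains s z Y where "s \<in> cyl t Z" "nd_P_set K Y" "Z \<subseteq> Y" "z \<in> W \<inter> Y" "z \<in> \<phi> s \<longleftrightarrow> c"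
proof -
  have W: "openin K W" using assms(3) unfolding clopenin_def by blast
  have "\<not> W \<subseteq> Z"
    using assms(2,4) W unfolding nd_P_set_def
    by (metis interior_of_maximal subset_empty)
  then obtain z where z: "z \<in> W" "z \<notin> Z" by blast
  have zK: "z \<in> topspace K" using z W openin_subset by blast
  obtain V where V: "clopenin K V" "z \<in> V" "V \<subseteq> topspace K - Z"
    using zero_dim[of "topspace K - Z" z] z zK assms(2) unfolding nd_P_set_def by blast
  define A where "A = (if c then \<phi> t \<union> V else \<phi> t - V)"
  have "clopenin K A" unfolding A_def using V clopenin_\<phi>[OF assms(1)] by auto
  then obtain s where s: "s \<in> T" "\<phi> s = A" using \<phi>_surj by blast
  obtain Y where Y: "nd_P_set K Y" "z \<in> Y" using cover zK by blast
  show thesis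
    by (rule that[of s "Z \<union> Y" z])
      (use s V Y z assms(2) nd_P_set_Un in \<open>auto simp: cyl_def A_def split: if_splits\<close>)
qed

text \<open>The points \<open>z\<close> decided along the way lie in the shrinking clopen sets \<open>W\<close> and accumulate at a
  point of their intersection; this is what allows the value \<open>c\<close> to be prescribed in the limit.\<close>

lemma dense_intersection_with_value:
  fixes R :: "nat \<Rightarrow> ('b \<times> 'a) set"
  assumes R: "\<And>n. openin (prod_topology E K) (R n)"
    "\<And>n. prod_topology E K closure_of R n = topspace (prod_topology E K)"
    and U: "openin (prod_topology E K) U" "U \<noteq> {}"
  obtains t x where "(t, x) \<in> U" "\<And>n. (t, x) \<in> R n" "x \<in> \<phi> t \<longleftrightarrow> c"
proof -
  define good where "good = (\<lambda>(t, Z, W). t \<in> T \<and> nd_P_set K Z \<and> clopenin K W \<and> W \<noteq> {})"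
  \<comment> \<open>A triple \<open>(t, Z, W)\<close> stands for the box
    \<open>cyl t Z \<times> W\<close>. A step shrinks the box into \<open>R n\<close> and freezes
    the value \<open>c\<close> at a point \<open>z\<close> of the old \<open>W\<close>: since
    \<open>z\<close> lies in \<open>Z'\<close>, all later clopen sets agree at
    \<open>z\<close>.\<close>
  define step where "step = (\<lambda>n (t, Z, W) (t', Z', W').
     t' \<in> cyl t Z \<and> Z \<subseteq> Z' \<and> W' \<subseteq> W \<and> cyl t' Z' \<times> W' \<subseteq> R n \<and> (\<exists>z \<in> W \<inter> Z'. z \<in> \<phi> t' \<longleftrightarrow> c))"
  obtain t0 x0 where tx0: "(t0, x0) \<in> U" using U(2) by auto
  then have t0: "t0 \<in> T" using openin_subset[OF U(1)] by (auto simp: topspace_E)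
  obtain Z0 W0 where ZW0: "nd_P_set K Z0" "clopenin K W0" "x0 \<in> W0" "cyl t0 Z0 \<times> W0 \<subseteq> U"
    using box_in_open[OF U(1) tx0] .
  have "\<exists>q. good q \<and> step n p q" if "good p" for n p
  proof -
    obtain t Z W where p: "p = (t, Z, W)" by (cases p)
    then have g: "t \<in> T" "nd_P_set K Z" "clopenin K W" "W \<noteq> {}" using that unfolding good_def by auto
    obtain s z Y where s: "s \<in> cyl t Z" "nd_P_set K Y" "Z \<subseteq> Y" "z \<in> W \<inter> Y" "z \<in> \<phi> s \<longleftrightarrow> c"
      using decide_point[OF g] .
    have "openin (prod_topology E K) (cyl s Y \<times> W)"
      using g(3) s(2) openin_cyl unfolding clopenin_def by (simp add: openin_prod_Times_iff)
    moreover have "cyl s Y \<times> W \<noteq> {}" using s(1) g(4) unfolding cyl_def by auto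
    ultimately have "R n \<inter> (cyl s Y \<times> W) \<noteq> {}"
      using R(2)[of n] unfolding dense_intersects_open by blast
    then obtain r x where rx: "(r, x) \<in> R n" "r \<in> cyl s Y" "x \<in> W" by auto
    obtain Y' W' where YW: "nd_P_set K Y'" "clopenin K W'" "x \<in> W'" "cyl r Y' \<times> W' \<subseteq> R n"
      using box_in_open[OF R(1) rx(1)] .
    have "good (r, Y \<union> Y', W \<inter> W')"
      unfolding good_def using rx YW g s nd_P_set_Un by (auto simp: cyl_def)
    moreover have "step n p (r, Y \<union> Y', W \<inter> W')"
      unfolding step_def p using rx YW s by (auto simp: cyl_def)
    ultimately show ?thesis by blast
  qed
  moreover have "good (t0, Z0, W0)" using t0 ZW0 unfolding good_def by auto
  ultimately obtain f where f: "f 0 = (t0, Z0, W0)" "\<And>n. good (f n)" "\<And>n. step n (f n) (f (Suc n))"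
    \<comment> \<open>The conjunct for \<open>n = 0\<close> pins the start of the sequence to the
      box found inside \<open>U\<close>.\<close>
    using dependent_nat_choice[of "\<lambda>n p. good p \<and> (n = 0 \<longrightarrow> p = (t0, Z0, W0))" "\<lambda>n p q. step n p q"]
    by (metis nat.distinct(1))
  define t Z W where "t n = fst (f n)" and "Z n = fst (snd (f n))" and "W n = snd (snd (f n))" for n
  have f_eq: "f n = (t n, Z n, W n)" for n unfolding t_def Z_def W_def by simp
  have g: "t n \<in> T" "nd_P_set K (Z n)" "clopenin K (W n)" "W n \<noteq> {}" for n
    using f(2)[of n] unfolding f_eq good_def by auto
  have st: "t (Suc n) \<in> cyl (t n) (Z n)" "Z n \<subseteq> Z (Suc n)" "W (Suc n) \<subseteq> W n"
    "cyl (t (Suc n)) (Z (Suc n)) \<times> W (Suc n) \<subseteq> R n"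
    "\<exists>z \<in> W n \<inter> Z (Suc n). z \<in> \<phi> (t (Suc n)) \<longleftrightarrow> c" for n
    using f(3)[of n] unfolding f_eq step_def by auto
  have Zmono: "Z n \<subseteq> Z m" if "n \<le> m" for n m
    using lift_Suc_mono_le[of Z] st(2) that by blast
  have Wmono: "W m \<subseteq> W n" if "n \<le> m" for n m
    using lift_Suc_antimono_le[of W] st(3) that by blast
  have coh: "\<phi> (t m) \<inter> Z n = \<phi> (t n) \<inter> Z n" if "n \<le> m" for n m
    using that
  proof (induction rule: dec_induct)
    case (step m)
    then show ?case using st(1)[of m] Zmono[of n m] unfolding cyl_def by blast
  qed simp
  obtain B where "clopenin K B" "\<forall>n. B \<inter> Z n = \<phi> (t n) \<inter> Z n"
    using coherent_extension[of "\<lambda>n. \<phi> (t n)" Z, OF clopenin_\<phi>[OF g(1)] g(2) coh] by blast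
  then obtain s where s: "s \<in> T" "\<And>n. \<phi> s \<inter> Z n = \<phi> (t n) \<inter> Z n"
    using \<phi>_surj by metis
  \<comment> \<open>\<open>C n\<close> contains the point frozen at step \<open>n\<close>, because
    \<open>\<phi> s\<close> has the same trace on \<open>Z (Suc n)\<close> as
    \<open>\<phi> (t (Suc n))\<close>. Compactness then yields a point in all
    \<open>C n\<close>.\<close>
  define C where "C n = W n \<inter> (if c then \<phi> s else topspace K - \<phi> s)" for n
  have "clopenin K (C n)" for n
    unfolding C_def using g(3) clopenin_\<phi>[OF s(1)] by auto
  moreover have "C n \<noteq> {}" for n
  proof -
    obtain z where z: "z \<in> W n" "z \<in> Z (Suc n)" "z \<in> \<phi> (t (Suc n)) \<longleftrightarrow> c" using st(5) by blast
    then have "z \<in> \<phi> s \<longleftrightarrow> c" using s(2)[of "Suc n"] by blast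
    moreover have "z \<in> topspace K" using z(1) g(3)[of n] openin_subset unfolding clopenin_def by blast
    ultimately show ?thesis using z(1) unfolding C_def by auto
  qed
  moreover have "decseq C" unfolding C_def decseq_def using Wmono by auto
  ultimately have "(\<Inter>n. C n) \<noteq> {}"
    using compact_space_imp_nest[OF compact, of C] unfolding clopenin_def by blast
  then obtain x where x: "\<And>n. x \<in> C n" by blast
  have sx: "s \<in> cyl (t n) (Z n)" "x \<in> W n" for n
    using s x[of n] unfolding cyl_def C_def by auto
  show thesis
  proof (rule that[of s x])
    show "(s, x) \<in> U" using sx[of 0] ZW0(4) f(1) f_eq[of 0] by auto
    show "(s, x) \<in> R n" for n using sx[of "Suc n"] st(4)[of n] by blast
    show "x \<in> \<phi> s \<longleftrightarrow> c" using x[of 0] unfolding C_def by (auto split: if_splits)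
  qed
qed

text \<open>Dense open subsets of \<open>E\<close>, multiplied by \<open>topspace K\<close>, are
  dense open in the product, where the fusion argument applies.\<close>

lemma Baire_E: "Baire_space E"
  unfolding Baire_space_def
proof (intro allI impI)
  fix \<G> assume \<G>: "countable \<G> \<and> (\<forall>U\<in>\<G>. openin E U \<and> E closure_of U = topspace E)"
  \<comment> \<open>Inserting the whole space makes the family nonempty, so that
    \<open>from_nat_into\<close> enumerates it.\<close>
  define \<H> where "\<H> = insert (topspace E) \<G>"
  define R where "R n = from_nat_into \<H> n \<times> topspace K" for n
  have \<H>: "openin E (from_nat_into \<H> n)" "E closure_of (from_nat_into \<H> n) = topspace E" for n
    using from_nat_into[of \<H> n] \<G> unfolding \<H>_def by auto
  have R: "openin (prod_topology E K) (R n)"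
    "prod_topology E K closure_of R n = topspace (prod_topology E K)" for n
    unfolding R_def using \<H> by (auto simp: openin_prod_Times_iff closure_of_Times)
  show "E closure_of (topspace E \<inter> \<Inter>\<G>) = topspace E"
    unfolding dense_intersects_open
  proof (intro allI impI)
    fix U assume U: "openin E U \<and> U \<noteq> {}"
    then have "openin (prod_topology E K) (U \<times> topspace K)" "U \<times> topspace K \<noteq> {}"
      using nonempty by (auto simp: openin_prod_Times_iff)
    then obtain t x where tx: "(t, x) \<in> U \<times> topspace K" "\<And>n. (t, x) \<in> R n"
      using dense_intersection_with_value[where R = R and c = True, OF R] by metis
    have "t \<in> G" if "G \<in> \<G>" for G
    proof -
      have "countable \<H>" "G \<in> \<H>" using \<G> that unfolding \<H>_def by auto
      then obtain n where "from_nat_into \<H> n = G" by (metis from_nat_into_surj)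
      then show ?thesis using tx(2)[of n] unfolding R_def by auto
    qed
    then show "topspace E \<inter> \<Inter>\<G> \<inter> U \<noteq> {}" using tx(1) U openin_subset by blast
  qed
qed

section \<open>The evaluation function\<close>

definition e :: "'b \<times> 'a \<Rightarrow> nat" where
  "e = (\<lambda>(t, x). of_bool (x \<in> \<phi> t))"

lemma separately_continuous_e: "separately_continuous E K two_point e"
  unfolding separately_continuous_def
proof (intro conjI ballI)
  fix t assume t: "t \<in> topspace E"
  show "continuous_map K two_point (\<lambda>x. e (t, x))"
    unfolding continuous_map_def
  proof (intro conjI allI impI)
    fix U assume "openin two_point U"
    have "{x \<in> topspace K. e (t, x) \<in> U} =
        (if 1 \<in> U then \<phi> t else {}) \<union> (if 0 \<in> U then topspace K - \<phi> t else {})"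
      using t \<phi>_subset unfolding e_def topspace_E by auto
    moreover have "clopenin K \<dots>"
      using clopenin_\<phi> t unfolding topspace_E by auto
    ultimately show "openin K {x \<in> topspace K. e (t, x) \<in> U}" unfolding clopenin_def by simp
  qed (auto simp: e_def)
next
  fix x assume x: "x \<in> topspace K"
  show "continuous_map E two_point (\<lambda>t. e (t, x))"
    unfolding continuous_map_def
  proof (intro conjI allI impI)
    fix U assume "openin two_point U"
    have "{t \<in> topspace E. e (t, x) \<in> U} =
        (if 1 \<in> U then {t \<in> T. x \<in> \<phi> t \<longleftrightarrow> True} else {}) \<union>
        (if 0 \<in> U then {t \<in> T. x \<in> \<phi> t \<longleftrightarrow> False} else {})"
      unfolding e_def topspace_E by auto
    moreover have "openin E \<dots>"
      by (intro openin_Un) (auto intro: openin_section[OF x, of True, simplified] openin_section[OF x, of False, simplified])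
    ultimately show "openin E {t \<in> topspace E. e (t, x) \<in> U}" by simp
  qed (auto simp: e_def)
qed

text \<open>By the Baire property, \<open>U - B\<close> is meager for some nonempty open
  \<open>U\<close>. Continuity at a point of \<open>U \<inter> B\<close> would make \<open>e\<close>
  constant on \<open>G \<inter> B\<close> for an open \<open>G\<close> around it, but fusion finds a
  point of \<open>U \<inter> G \<inter> B\<close> with the opposite value.\<close>

lemma not_continuous_on_nonmeager_borel:
  assumes B: "B \<in> borel_sets_of (prod_topology E K)" "\<not> meager_in (prod_topology E K) B"
  shows "\<not> continuous_map (subtopology (prod_topology E K) B) two_point e"
proof
  let ?X = "prod_topology E K"
  assume cont: "continuous_map (subtopology ?X B) two_point e"
  obtain U where U: "openin ?X U" "meager_in ?X (B - U)" "meager_in ?X (U - B)"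
    using borel_sets_of_Baire_property[OF B(1)] .
  have "U \<noteq> {}" using U(2) B(2) by auto
  obtain \<N> where \<N>: "countable \<N>" "\<forall>N\<in>\<N>. nowhere_dense_in ?X N" "U - B = \<Union>\<N>"
    using U(3)[unfolded meager_in_def] by (elim exE conjE)
  define \<M> where "\<M> = insert {} \<N>"
  \<comment> \<open>The intersection of these dense open sets misses \<open>U - B\<close>, so its
    points in \<open>U\<close> lie in \<open>B\<close>.\<close>
  define R where "R n = topspace ?X - ?X closure_of (from_nat_into \<M> n)" for n
  have nd: "nowhere_dense_in ?X (from_nat_into \<M> n)" for n
    using from_nat_into[of \<M> n] \<N>(2) unfolding \<M>_def by (auto simp: nowhere_dense_in_def)
  have R: "openin ?X (R n)" "?X closure_of R n = topspace ?X" for n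
    using dense_complement_closure[OF nd[of n]] unfolding R_def by auto
  have in_B: "p \<in> B" if p: "p \<in> U" "\<And>n. p \<in> R n" for p
  proof (rule ccontr)
    assume "p \<notin> B"
    then obtain N where N: "N \<in> \<N>" "p \<in> N" using p(1) \<N>(3) by blast
    obtain n where n: "from_nat_into \<M> n = N"
      using from_nat_into_surj[of \<M> N] \<N>(1) N(1) unfolding \<M>_def by blast
    have "N \<subseteq> ?X closure_of N"
      using nd[of n] closure_of_subset[of N ?X] unfolding n nowhere_dense_in_def by simp
    then show False using p(2)[of n] N(2) n unfolding R_def by auto
  qed
  obtain t x where tx: "(t, x) \<in> U" "\<And>n. (t, x) \<in> R n"
    using dense_intersection_with_value[where R = R and c = True, OF R U(1) \<open>U \<noteq> {}\<close>] by blast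
  define c where "c = e (t, x)"
  have "openin two_point {c}" unfolding c_def e_def by auto
  then have "openin (subtopology ?X B) {p \<in> topspace (subtopology ?X B). e p \<in> {c}}"
    using cont unfolding continuous_map_def by blast
  then obtain G where G: "openin ?X G" "{p \<in> topspace (subtopology ?X B). e p \<in> {c}} = G \<inter> B"
    unfolding openin_subtopology by blast
  have B_sub: "U \<inter> B \<subseteq> topspace (subtopology ?X B)"
    using openin_subset[OF U(1)] by (simp add: le_infI1)
  have "(t, x) \<in> U \<inter> G" using G(2)[unfolded set_eq_iff, rule_format, of "(t, x)"] tx(1) in_B[OF tx] subsetD[OF B_sub, of "(t, x)"] unfolding c_def by simp
  then obtain s y where sy: "(s, y) \<in> U \<inter> G" "\<And>n. (s, y) \<in> R n" "y \<in> \<phi> s \<longleftrightarrow> x \<notin> \<phi> t"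
    using dense_intersection_with_value[where R = R and U = "U \<inter> G" and c = "x \<notin> \<phi> t", OF R] U(1) G(1) by blast
  have "e (s, y) = c" using G(2)[unfolded set_eq_iff, rule_format, of "(s, y)"] sy(1) in_B[OF _ sy(2)] by simp
  then show False using sy(3) unfolding c_def e_def by auto
qed

end

section \<open>Ultrafilters avoiding a sigma-ideal\<close>

locale sigma_ideal =
  fixes I :: "'d set set"
  assumes empty: "{} \<in> I"
    and proper: "UNIV \<notin> I"
    and subset: "A \<in> I \<Longrightarrow> B \<subseteq> A \<Longrightarrow> B \<in> I"
    and UN: "\<And>A :: nat \<Rightarrow> 'd set. (\<And>n. A n \<in> I) \<Longrightarrow> (\<Union>n. A n) \<in> I"
begin

lemma Un: "A \<in> I \<Longrightarrow> B \<in> I \<Longrightarrow> A \<union> B \<in> I"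
  using UN[of "\<lambda>n. if n = 0 then A else B"] by (rule subset) (auto split: if_splits)

definition fip :: "'d set set \<Rightarrow> bool" where
  "fip \<A> \<longleftrightarrow> (\<forall>\<F>. finite \<F> \<and> \<F> \<subseteq> \<A> \<longrightarrow> \<Inter>\<F> \<notin> I)"

text \<open>The ultrafilters disjoint from \<open>I\<close>, that is, those of the power set algebra
  modulo \<open>I\<close>. Upward closure, even modulo \<open>I\<close>, follows in
  \<open>ult_mono\<close>.\<close>

definition ult :: "'d set set set" where
  "ult = {x. (\<forall>A\<in>x. A \<notin> I) \<and> (\<forall>A B. A \<in> x \<longrightarrow> B \<in> x \<longrightarrow> A \<inter> B \<in> x) \<and> (\<forall>A. A \<in> x \<or> - A \<in> x)}"

lemma ult_pos: "x \<in> ult \<Longrightarrow> A \<in> x \<Longrightarrow> A \<notin> I"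
  and ult_Int: "x \<in> ult \<Longrightarrow> A \<in> x \<Longrightarrow> B \<in> x \<Longrightarrow> A \<inter> B \<in> x"
  and ult_or: "x \<in> ult \<Longrightarrow> A \<in> x \<or> - A \<in> x"
  unfolding ult_def by auto

lemma ult_Compl: "x \<in> ult \<Longrightarrow> - A \<in> x \<longleftrightarrow> A \<notin> x"
  using ult_or[of x A] ult_Int[of x A "- A"] ult_pos[of x "{}"] empty by auto

lemma ult_mono: "x \<in> ult \<Longrightarrow> A \<in> x \<Longrightarrow> A - B \<in> I \<Longrightarrow> B \<in> x"
  using ult_Compl[of x B] ult_Int[of x A "- B"] ult_pos[of x "A \<inter> - B"] by (auto simp: Diff_eq)

lemma ult_Int_iff: "x \<in> ult \<Longrightarrow> A \<inter> B \<in> x \<longleftrightarrow> A \<in> x \<and> B \<in> x"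
  using ult_Int ult_mono[of x "A \<inter> B" A] ult_mono[of x "A \<inter> B" B] empty
  by (metis Diff_eq_empty_iff inf_le1 inf_le2)

lemma ult_UNIV: "x \<in> ult \<Longrightarrow> UNIV \<in> x"
  using ult_or[of x UNIV] ult_pos[of x "{}"] empty by auto

text \<open>Zorn's lemma gives a maximal family with the finite intersection property modulo
  \<open>I\<close>.\<close>

lemma fip_imp_ult:
  assumes "fip \<A>"
  obtains x where "x \<in> ult" "\<A> \<subseteq> x"
proof -
  let ?S = "{x. fip x \<and> \<A> \<subseteq> x}"
  have "\<exists>M\<in>?S. \<forall>X\<in>?S. M \<subseteq> X \<longrightarrow> X = M"
  proof (rule subset_Zorn_nonempty)
    show "?S \<noteq> {}" using assms by auto
    fix \<C> assume \<C>: "\<C> \<noteq> {}" "subset.chain ?S \<C>"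
    have "fip (\<Union>\<C>)"
      unfolding fip_def
    proof (intro allI impI)
      fix \<F> assume \<F>: "finite \<F> \<and> \<F> \<subseteq> \<Union>\<C>"
      then obtain C where "C \<in> \<C>" "\<F> \<subseteq> C"
        using finite_subset_Union_chain[of \<F> \<C> ?S] \<C> by blast
      moreover have "fip C" using \<open>C \<in> \<C>\<close> \<C>(2) unfolding subset.chain_def by auto
      ultimately show "\<Inter>\<F> \<notin> I" using \<F> unfolding fip_def by blast
    qed
    moreover have "\<A> \<subseteq> \<Union>\<C>" using \<C> unfolding subset.chain_def by blast
    ultimately show "\<Union>\<C> \<in> ?S" by auto
  qed
  then obtain x where "x \<in> ?S" "\<forall>X\<in>?S. x \<subseteq> X \<longrightarrow> X = x" by (elim bexE)
  then have x: "fip x" "\<A> \<subseteq> x" "\<And>y. fip y \<Longrightarrow> x \<subseteq> y \<Longrightarrow> y = x" by auto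
  \<comment> \<open>By maximality, \<open>x\<close> contains every set that meets each finite
    intersection from \<open>x\<close> in a set outside \<open>I\<close>.\<close>
  have in_x: "A \<in> x" if "\<And>\<F>. finite \<F> \<Longrightarrow> \<F> \<subseteq> x \<Longrightarrow> \<Inter>\<F> \<inter> A \<notin> I" for A
  proof -
    have "fip (insert A x)"
      unfolding fip_def
    proof (intro allI impI)
      fix \<F> assume \<F>: "finite \<F> \<and> \<F> \<subseteq> insert A x"
      have "\<Inter>(\<F> - {A}) \<inter> A \<notin> I" using \<F> by (intro that) auto
      moreover have "\<Inter>(\<F> - {A}) \<inter> A \<subseteq> \<Inter>\<F>" by auto
      ultimately show "\<Inter>\<F> \<notin> I" using subset by blast
    qed
    then show ?thesis using x(3) by blast
  qed
  have fin: "\<Inter>\<F> \<notin> I" if "finite \<F>" "\<F> \<subseteq> x" for \<F>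
    using x(1) that unfolding fip_def by blast
  have "x \<in> ult"
    unfolding ult_def
  proof (intro CollectI conjI ballI allI impI)
    show "A \<notin> I" if "A \<in> x" for A using fin[of "{A}"] that by auto
    show "A \<inter> B \<in> x" if "A \<in> x" "B \<in> x" for A B
    proof (rule in_x)
      fix \<F> assume "finite \<F>" "\<F> \<subseteq> x"
      then show "\<Inter>\<F> \<inter> (A \<inter> B) \<notin> I" using fin[of "insert A (insert B \<F>)"] that
        by (simp add: ac_simps)
    qed
    show "A \<in> x \<or> - A \<in> x" for A
    proof (rule ccontr)
      assume "\<not> (A \<in> x \<or> - A \<in> x)"
      then obtain \<F> \<G> where F: "finite \<F>" "\<F> \<subseteq> x" "\<Inter>\<F> \<inter> A \<in> I"
        and G: "finite \<G>" "\<G> \<subseteq> x" "\<Inter>\<G> \<inter> - A \<in> I"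
        using in_x by metis
      \<comment> \<open>\<open>A\<close> and its complement split this intersection into two sets of
        the ideal.\<close>
      have "\<Inter>(\<F> \<union> \<G>) \<in> I"
        by (rule subset[OF Un[OF F(3) G(3)]]) auto
      moreover have "\<Inter>(\<F> \<union> \<G>) \<notin> I"
        by (rule fin) (use F G in auto)
      ultimately show False by simp
    qed
  qed
  then show thesis using that x(2) by blast
qed

section \<open>The Stone space of the power set algebra modulo the ideal\<close>

definition stone :: "'d set \<Rightarrow> 'd set set set" where
  "stone A = {x \<in> ult. A \<in> x}"

lemma stone_Int: "stone (A \<inter> B) = stone A \<inter> stone B"
  unfolding stone_def using ult_Int_iff by auto

lemma stone_Compl: "stone (- A) = ult - stone A"
  unfolding stone_def using ult_Compl by auto

lemma stone_Un: "stone (A \<union> B) = stone A \<union> stone B"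
proof -
  have "stone (- (- A \<inter> - B)) = ult - ((ult - stone A) \<inter> (ult - stone B))"
    by (simp only: stone_Compl stone_Int)
  then show ?thesis unfolding stone_def by auto
qed

lemma stone_empty: "stone {} = {}"
  unfolding stone_def using ult_pos empty by auto

lemma stone_subset_ult: "stone A \<subseteq> ult"
  unfolding stone_def by auto

lemma stone_UNIV: "stone UNIV = ult"
  unfolding stone_def using ult_UNIV by auto

lemma stone_mono: "A - B \<in> I \<Longrightarrow> stone A \<subseteq> stone B"
  unfolding stone_def using ult_mono by auto

text \<open>A set outside \<open>I\<close> has \<open>fip\<close> on its own and so belongs to an
  ultrafilter. Disjointness of clopen sets thereby becomes a statement about
  \<open>I\<close>.\<close>

lemma stone_eq_empty_iff: "stone A = {} \<longleftrightarrow> A \<in> I"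
proof
  show "stone A = {}" if "A \<in> I" using stone_mono[of A "{}"] that stone_empty by auto
  show "A \<in> I" if "stone A = {}"
  proof (rule ccontr)
    assume A: "A \<notin> I"
    have "fip {A}" unfolding fip_def
    proof (intro allI impI)
      fix \<F> assume "finite \<F> \<and> \<F> \<subseteq> {A}"
      then have "A \<subseteq> \<Inter>\<F>" by auto
      then show "\<Inter>\<F> \<notin> I" using A subset by blast
    qed
    then show False using fip_imp_ult[of "{A}"] that unfolding stone_def by blast
  qed
qed

definition K :: "'d set set topology" where
  "K = topology (\<lambda>U. U \<subseteq> ult \<and> (\<forall>x\<in>U. \<exists>A. x \<in> stone A \<and> stone A \<subseteq> U))"

lemma openin_K: "openin K U \<longleftrightarrow> U \<subseteq> ult \<and> (\<forall>x\<in>U. \<exists>A. x \<in> stone A \<and> stone A \<subseteq> U)"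
proof -
  have "istopology (\<lambda>U. U \<subseteq> ult \<and> (\<forall>x\<in>U. \<exists>A. x \<in> stone A \<and> stone A \<subseteq> U))"
    unfolding istopology_def
  proof (intro conjI allI impI)
    fix U V
    assume UV: "U \<subseteq> ult \<and> (\<forall>x\<in>U. \<exists>A. x \<in> stone A \<and> stone A \<subseteq> U)"
      "V \<subseteq> ult \<and> (\<forall>x\<in>V. \<exists>A. x \<in> stone A \<and> stone A \<subseteq> V)"
    show "U \<inter> V \<subseteq> ult" using UV by auto
    show "\<forall>x\<in>U \<inter> V. \<exists>A. x \<in> stone A \<and> stone A \<subseteq> U \<inter> V"
    proof
      fix x assume "x \<in> U \<inter> V"
      then obtain A B where "x \<in> stone A" "stone A \<subseteq> U" "x \<in> stone B" "stone B \<subseteq> V"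
        using UV by (meson IntD1 IntD2)
      then show "\<exists>A. x \<in> stone A \<and> stone A \<subseteq> U \<inter> V"
        by (intro exI[of _ "A \<inter> B"]) (auto simp: stone_Int)
    qed
  next
    fix \<K> assume *: "\<forall>U\<in>\<K>. U \<subseteq> ult \<and> (\<forall>x\<in>U. \<exists>A. x \<in> stone A \<and> stone A \<subseteq> U)"
    then show "\<Union>\<K> \<subseteq> ult" by auto
    show "\<forall>x\<in>\<Union>\<K>. \<exists>A. x \<in> stone A \<and> stone A \<subseteq> \<Union>\<K>"
      using * by (meson Union_iff Union_upper subset_trans)
  qed
  then show ?thesis unfolding K_def by (simp add: topology_inverse')
qed

lemma openin_stone: "openin K (stone A)"
  unfolding openin_K using stone_subset_ult by auto

lemma topspace_K: "topspace K = ult"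
proof -
  have "openin K ult" using openin_stone[of UNIV] by (simp add: stone_UNIV)
  then show ?thesis using openin_subset openin_K by (metis openin_topspace subset_antisym)
qed

lemma closedin_stone: "closedin K (stone A)"
  using openin_stone[of "- A"] stone_subset_ult
  unfolding closedin_def topspace_K by (simp add: stone_Compl)

lemma clopenin_stone: "clopenin K (stone A)"
  unfolding clopenin_def using openin_stone closedin_stone by auto

text \<open>If no finite subfamily covered everything modulo \<open>I\<close>, the complements would
  have \<open>fip\<close>, and an ultrafilter containing them would lie in no
  \<open>stone A\<close>.\<close>

lemma compact_cover:
  assumes "ult \<subseteq> \<Union>(stone ` \<A>)"
  obtains \<F> where "finite \<F>" "\<F> \<subseteq> \<A>" "ult \<subseteq> stone (\<Union>\<F>)"
proof -
  have "\<not> fip (uminus ` \<A>)"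
  proof
    assume "fip (uminus ` \<A>)"
    then obtain x where x: "x \<in> ult" "uminus ` \<A> \<subseteq> x" using fip_imp_ult by blast
    then obtain A where "A \<in> \<A>" "A \<in> x" using assms unfolding stone_def by blast
    then show False using x ult_Compl[of x A] by blast
  qed
  then obtain \<G> where \<G>: "finite \<G>" "\<G> \<subseteq> uminus ` \<A>" "\<Inter>\<G> \<in> I"
    unfolding fip_def by blast
  then obtain \<F> where \<F>: "finite \<F>" "\<F> \<subseteq> \<A>" "\<G> = uminus ` \<F>"
    by (meson finite_subset_image)
  have "- (\<Union>\<F>) \<in> I" using \<G>(3) unfolding \<F>(3) by (simp add: uminus_Sup)
  then have "stone (- (\<Union>\<F>)) = {}" using stone_eq_empty_iff by blast
  then show thesis using that \<F> unfolding stone_Compl by blast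
qed

lemma stone_Union: "finite \<F> \<Longrightarrow> stone (\<Union>\<F>) = \<Union>(stone ` \<F>)"
  by (induction rule: finite_induct) (auto simp: stone_empty stone_Un)

lemma compact_K: "compact_space K"
  unfolding compact_space_alt topspace_K
proof (intro allI impI)
  fix \<U> assume *: "(\<forall>U\<in>\<U>. openin K U) \<and> ult \<subseteq> \<Union>\<U>"
  have "\<exists>U\<in>\<U>. \<exists>A. x \<in> stone A \<and> stone A \<subseteq> U" if "x \<in> ult" for x
    using * that unfolding openin_K by (meson Union_iff subsetD)
  then have "ult \<subseteq> \<Union>(stone ` {A. \<exists>U\<in>\<U>. stone A \<subseteq> U})" by blast
  then obtain \<F> where \<F>: "finite \<F>" "\<F> \<subseteq> {A. \<exists>U\<in>\<U>. stone A \<subseteq> U}" "ult \<subseteq> stone (\<Union>\<F>)"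
    using compact_cover by blast
  from \<F>(2) have "\<forall>A\<in>\<F>. \<exists>U. U \<in> \<U> \<and> stone A \<subseteq> U" by auto
  then obtain g where g: "\<And>A. A \<in> \<F> \<Longrightarrow> g A \<in> \<U> \<and> stone A \<subseteq> g A" by metis
  show "\<exists>\<F>. finite \<F> \<and> \<F> \<subseteq> \<U> \<and> ult \<subseteq> \<Union>\<F>"
    using \<F>(1,3) g unfolding stone_Union[OF \<F>(1)] by (intro exI[of _ "g ` \<F>"]) blast
qed

lemma Hausdorff_K: "Hausdorff_space K"
  unfolding Hausdorff_space_def topspace_K
proof (intro allI impI)
  fix x y assume xy: "x \<in> ult \<and> y \<in> ult \<and> x \<noteq> y"
  have "\<exists>A. A \<in> x \<and> A \<notin> y"
  proof (rule ccontr)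
    assume "\<nexists>A. A \<in> x \<and> A \<notin> y"
    then have "A \<in> x \<longleftrightarrow> A \<in> y" for A using xy ult_Compl by blast
    then show False using xy by blast
  qed
  then obtain A where "A \<in> x" "A \<notin> y" by blast
  then have "x \<in> stone A" "y \<in> stone (- A)" "disjnt (stone A) (stone (- A))"
    using xy ult_Compl by (auto simp: stone_def disjnt_def)
  then show "\<exists>U V. openin K U \<and> openin K V \<and> x \<in> U \<and> y \<in> V \<and> disjnt U V"
    using openin_stone by blast
qed

text \<open>Basic sets that lie in \<open>U\<close> or miss \<open>C\<close> cover the space; from a
  finite subcover, the union of those members that lie in \<open>U\<close> is as required.\<close>

lemma closed_subset_open:
  assumes "closedin K C" "openin K U" "C \<subseteq> U"
  obtains A where "C \<subseteq> stone A" "stone A \<subseteq> U"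
proof -
  have "openin K (ult - C)" using assms(1) unfolding closedin_def topspace_K by blast
  then have "\<exists>A. x \<in> stone A \<and> (stone A \<subseteq> U \<or> stone A \<inter> C = {})" if "x \<in> ult" for x
  proof (cases "x \<in> C")
    case True
    then show ?thesis using assms(2,3) unfolding openin_K by (meson subsetD)
  next
    case False
    have "\<forall>y\<in>ult - C. \<exists>A. y \<in> stone A \<and> stone A \<subseteq> ult - C"
      using \<open>openin K (ult - C)\<close> unfolding openin_K by (rule conjunct2)
    with False that obtain A where "x \<in> stone A" "stone A \<subseteq> ult - C" by auto
    then show ?thesis by (intro exI[of _ A]) auto
  qed
  then have "ult \<subseteq> \<Union>(stone ` {A. stone A \<subseteq> U \<or> stone A \<inter> C = {}})" by blast
  then obtain \<F> where \<F>: "finite \<F>" "\<F> \<subseteq> {A. stone A \<subseteq> U \<or> stone A \<inter> C = {}}" "ult \<subseteq> stone (\<Union>\<F>)"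
    by (rule compact_cover)
  have C: "C \<subseteq> ult" using closedin_subset[OF assms(1)] unfolding topspace_K .
  have fin: "finite {A \<in> \<F>. stone A \<subseteq> U}" using \<F>(1) by auto
  show thesis
  proof (rule that)
    show "C \<subseteq> stone (\<Union>{A \<in> \<F>. stone A \<subseteq> U})"
    proof
      fix x assume "x \<in> C"
      moreover from this obtain A where "A \<in> \<F>" "x \<in> stone A"
        using \<F>(3) C unfolding stone_Union[OF \<F>(1)] by auto
      moreover from this have "stone A \<subseteq> U \<or> stone A \<inter> C = {}" using \<F>(2) by auto
      ultimately show "x \<in> stone (\<Union>{A \<in> \<F>. stone A \<subseteq> U})"
        unfolding stone_Union[OF fin] by auto
    qed
    show "stone (\<Union>{A \<in> \<F>. stone A \<subseteq> U}) \<subseteq> U"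
      unfolding stone_Union[OF fin] by blast
  qed
qed

lemma clopenin_iff_stone: "clopenin K U \<longleftrightarrow> (\<exists>A. U = stone A)"
proof
  assume "clopenin K U"
  then have "closedin K U" "openin K U" "U \<subseteq> U" unfolding clopenin_def by auto
  then obtain A where "U \<subseteq> stone A" "stone A \<subseteq> U" by (rule closed_subset_open)
  then show "\<exists>A. U = stone A" by auto
qed (use clopenin_stone in auto)

text \<open>Representatives \<open>p m\<close> and \<open>q n\<close> meet in sets of
  \<open>I\<close>. As \<open>I\<close> is closed under countable unions, the union of all
  \<open>p m\<close> also meets each \<open>q n\<close> in a set of \<open>I\<close>.\<close>

lemma separation_K:
  fixes P Q :: "nat \<Rightarrow> 'd set set set"
  assumes "\<And>n. clopenin K (P n)" "\<And>n. clopenin K (Q n)" "\<And>m n. P m \<inter> Q n = {}"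
  shows "\<exists>A. clopenin K A \<and> (\<forall>n. P n \<subseteq> A \<and> Q n \<inter> A = {})"
proof -
  obtain p q where pq: "\<And>n. P n = stone (p n)" "\<And>n. Q n = stone (q n)"
    using assms(1,2) unfolding clopenin_iff_stone by metis
  have "p m \<inter> q n \<in> I" for m n
    using assms(3)[of m n] unfolding pq stone_Int[symmetric] stone_eq_empty_iff .
  then have "(\<Union>m. p m \<inter> q n) \<in> I" for n by (rule UN)
  then have "q n \<inter> (\<Union>m. p m) \<in> I" for n by (rule subset) auto
  then have "Q n \<inter> stone (\<Union>m. p m) = {}" for n
    unfolding pq stone_Int[symmetric] stone_eq_empty_iff .
  moreover have "P n \<subseteq> stone (\<Union>m. p m)" for n
  proof -
    have "p n - (\<Union>m. p m) = {}" by blast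
    then show ?thesis unfolding pq using empty stone_mono by metis
  qed
  ultimately show ?thesis using clopenin_stone by blast
qed

text \<open>\<open>bd\<close> makes the \<open>F w\<close> countably directed downwards, which
  yields the P-set condition. \<open>unb\<close> says that no set outside \<open>I\<close> is
  contained modulo \<open>I\<close> in all \<open>F w\<close>, which yields empty interior.\<close>

lemma nd_P_set_filter:
  fixes F :: "'w \<Rightarrow> 'd set"
  assumes bd: "\<And>w :: nat \<Rightarrow> 'w. (\<And>n. w n \<in> J) \<Longrightarrow> \<exists>v\<in>J. \<forall>n. F v \<subseteq> F (w n)"
    and unb: "\<And>A. A \<notin> I \<Longrightarrow> \<exists>w\<in>J. A - F w \<notin> I"
  shows "nd_P_set K (\<Inter>w\<in>J. stone (F w))"
proof -
  let ?Z = "\<Inter>w\<in>J. stone (F w)"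
  have J: "J \<noteq> {}" using unb[OF proper] by auto
  have closed: "closedin K ?Z" using J closedin_stone by (intro closedin_Inter) auto
  have "K interior_of ?Z = {}"
  proof (rule ccontr)
    assume "K interior_of ?Z \<noteq> {}"
    then obtain x where x: "x \<in> K interior_of ?Z" by auto
    have "openin K (K interior_of ?Z)" by simp
    then have "\<forall>x\<in>K interior_of ?Z. \<exists>A. x \<in> stone A \<and> stone A \<subseteq> K interior_of ?Z"
      unfolding openin_K by (rule conjunct2)
    with x obtain A where "x \<in> stone A" "stone A \<subseteq> K interior_of ?Z" by auto
    with interior_of_subset[of K ?Z] have A: "x \<in> stone A" "stone A \<subseteq> ?Z" by (auto simp: subset_iff)
    then have "A \<notin> I" using stone_eq_empty_iff by blast
    then obtain w where "w \<in> J" "A - F w \<notin> I" using unb by blast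
    then have "stone (A \<inter> - F w) \<noteq> {}" unfolding stone_eq_empty_iff by (simp add: Diff_eq)
    then show False using A(2) \<open>w \<in> J\<close> unfolding stone_Int stone_Compl by blast
  qed
  moreover have "\<exists>V. openin K V \<and> ?Z \<subseteq> V \<and> (\<forall>n. V \<subseteq> U n)"
    if U: "\<forall>n. openin K (U n) \<and> ?Z \<subseteq> U n" for U :: "nat \<Rightarrow> _"
  proof -
    \<comment> \<open>By compactness a single \<open>stone (F w)\<close> already fits into
      \<open>U n\<close>.\<close>
    have "\<exists>w\<in>J. stone (F w) \<subseteq> U n" for n
    proof -
      from U have "openin K (U n)" "?Z \<subseteq> U n" by auto
      with closed obtain A where A: "?Z \<subseteq> stone A" "stone A \<subseteq> U n"
        by (rule closed_subset_open)
      have "ult \<subseteq> \<Union>(stone ` (insert A ((\<lambda>w. - F w) ` J)))"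
        using A(1) by (auto simp: stone_Compl)
      then obtain \<F> where \<F>: "finite \<F>" "\<F> \<subseteq> insert A ((\<lambda>w. - F w) ` J)" "ult \<subseteq> stone (\<Union>\<F>)"
        by (rule compact_cover)
      have "finite (\<F> - {A})" "\<F> - {A} \<subseteq> (\<lambda>w. - F w) ` J" using \<F> by auto
      then obtain G where G: "finite G" "G \<subseteq> J" "\<F> - {A} = (\<lambda>w. - F w) ` G"
        by (meson finite_subset_image)
      obtain w0 where "w0 \<in> J" using J by blast
      \<comment> \<open>\<open>bd\<close> speaks of sequences, so the finite set \<open>G\<close> is
        enumerated with repetitions; \<open>w0\<close> covers the case of empty
        \<open>G\<close>.\<close>
      define w where "w = from_nat_into (insert w0 G)"
      have wr: "range w = insert w0 G"
        unfolding w_def using G(1) by (intro range_from_nat_into) (auto intro: countable_finite)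
      then have "w n \<in> J" for n using G(2) \<open>w0 \<in> J\<close> rangeI[of w n] by auto
      then obtain v where v: "v \<in> J" "\<forall>n. F v \<subseteq> F (w n)"
        using bd[of w] by auto
      have Fv: "F v \<subseteq> F u" if "u \<in> G" for u
        using v(2) wr that by (metis imageE insertCI)
      have "stone (F v) \<subseteq> stone A"
      proof
        fix x assume x: "x \<in> stone (F v)"
        then obtain B where B: "B \<in> \<F>" "x \<in> stone B"
          using \<F>(3) stone_subset_ult unfolding stone_Union[OF \<F>(1)] by blast
        show "x \<in> stone A"
        proof (cases "B = A")
          case False
          then obtain u where u: "u \<in> G" "B = - F u" using B(1) G(3) by blast
          then have "x \<notin> stone (F u)" using B(2) unfolding stone_Compl u(2) by blast
          moreover have "stone (F v) \<subseteq> stone (F u)"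
            using Fv[OF u(1)] empty by (intro stone_mono) (simp add: Diff_eq_empty_iff[THEN iffD2])
          ultimately show ?thesis using x by auto
        qed (use B in simp)
      qed
      then show ?thesis using v(1) A(2) by blast
    qed
    then obtain w where w: "\<And>n. w n \<in> J \<and> stone (F (w n)) \<subseteq> U n" by metis
    then obtain v where v: "v \<in> J" "\<forall>n. F v \<subseteq> F (w n)" using bd[of w] by auto
    have "stone (F v) \<subseteq> U n" for n
    proof -
      have "stone (F v) \<subseteq> stone (F (w n))"
        using v(2) empty by (intro stone_mono) (simp add: Diff_eq_empty_iff[THEN iffD2])
      then show ?thesis using w[of n] by auto
    qed
    then show ?thesis using v(1) openin_stone by (intro exI[of _ "stone (F v)"]) auto
  qed
  ultimately show ?thesis unfolding nd_P_set_def using closed by blast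
qed

end

section \<open>The constraint on functions from the second to the first uncountable cardinal\<close>

unbundle cardinal_syntax

lemma card_of_subset_ordLeq: "A \<subseteq> B \<Longrightarrow> |B| \<le>o |C| \<Longrightarrow> |A| \<le>o |C|"
  by (rule ordLeq_transitive[OF card_of_mono1])

text \<open>\<open>S\<close> is the field of the cardinal successor of \<open>|W|\<close>, whose
  proper initial segments have cardinality at most \<open>|W|\<close>. Its elements are sets over
  the type of \<open>W\<close>, so each application climbs one type level.\<close>

lemma infinite_successor_order:
  fixes W :: "'w set"
  assumes "infinite W"
  obtains S :: "'w set set" and r :: "'w set rel"
  where "\<not> |S| \<le>o |W|" "\<And>a b. a \<in> S \<Longrightarrow> b \<in> S \<Longrightarrow> (a, b) \<in> r \<or> (b, a) \<in> r"
    "trans r" "\<And>a. a \<in> S \<Longrightarrow> |{b \<in> S. (b, a) \<in> r}| \<le>o |W|"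
proof -
  define r where "r = cardSuc |W|"
  have r: "Card_order r" unfolding r_def by (rule cardSuc_Card_order[OF card_of_Card_order])
  then have wo: "Well_order r" unfolding card_order_on_def by blast
  have "\<not> |Field r| \<le>o |W|"
  proof
    assume "|Field r| \<le>o |W|"
    then have "r \<le>o |W|"
      using card_of_Field_ordIso[OF r] ordIso_ordLeq_trans ordIso_symmetric by blast
    moreover have "|W| <o r" unfolding r_def by (rule cardSuc_greater[OF card_of_Card_order])
    ultimately show False using not_ordLess_ordLeq by blast
  qed
  moreover have "(a, b) \<in> r \<or> (b, a) \<in> r" if "a \<in> Field r" "b \<in> Field r" for a b
    using wo that
    unfolding well_order_on_def linear_order_on_def partial_order_on_def preorder_on_def
      total_on_def refl_on_def
    by metis
  moreover have "trans r"
    using wo unfolding well_order_on_def linear_order_on_def partial_order_on_def preorder_on_def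
    by blast
  moreover have "|{b \<in> Field r. (b, a) \<in> r}| \<le>o |W|" if "a \<in> Field r" for a
  proof -
    have "|underS r a| \<le>o |W|"
      using card_of_underS[OF r that]
        cardSuc_ordLeq_ordLess[OF card_of_Card_order[of W] card_of_Card_order[of "underS r a"]]
      unfolding r_def by simp
    moreover have "|{a}| \<le>o |W|"
      using assms by (intro card_of_singl_ordLeq) auto
    ultimately have "|{a} \<union> underS r a| \<le>o |W|"
      using assms
      by (intro card_of_Un_ordLeq_infinite_Field) (simp_all add: Field_card_of card_of_card_order_on)
    then show ?thesis by (rule card_of_subset_ordLeq[rotated]) (auto simp: underS_def)
  qed
  ultimately show thesis using that by blast
qed

text \<open>The model is \<open>W = \<omega>\<^sub>1\<close>, \<open>S = \<omega>\<^sub>2\<close>, and \<open>h(\<cdot>, j)\<close> injective from \<open>j\<close> into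
  \<open>\<omega>\<^sub>1\<close> for every \<open>j < \<omega>\<^sub>2\<close>.\<close>

locale coloring =
  fixes W :: "'w set" and r :: "'w rel" and S :: "'i set" and h :: "'i \<Rightarrow> 'i \<Rightarrow> 'w"
  assumes infinite_W: "infinite W"
    and total: "\<And>a b. a \<in> W \<Longrightarrow> b \<in> W \<Longrightarrow> (a, b) \<in> r \<or> (b, a) \<in> r"
    and trans_r: "trans r"
    and bounded: "\<And>C. countable C \<Longrightarrow> C \<subseteq> W \<Longrightarrow> \<exists>b\<in>W. \<forall>c\<in>C. (c, b) \<in> r"
    and pigeonhole: "\<And>\<alpha>. (\<And>i. i \<in> S \<Longrightarrow> \<alpha> i \<in> W) \<Longrightarrow>
      \<exists>i\<in>S. \<exists>j\<in>S. i \<noteq> j \<and> (h i j, \<alpha> i) \<notin> r \<and> (h i j, \<alpha> j) \<notin> r"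
    and small_solution: "\<And>T. T \<subseteq> S \<Longrightarrow> |T| \<le>o |W| \<Longrightarrow>
      \<exists>z. \<forall>i\<in>T. z i \<in> W \<and> (\<forall>j\<in>T. i \<noteq> j \<longrightarrow> (h i j, z i) \<in> r \<or> (h i j, z j) \<in> r)"

lemma coloring_exists:
  obtains W :: "nat set set" and r and S :: "nat set set set" and h
  where "coloring W r S h"
proof -
  obtain W :: "nat set set" and r :: "nat set rel" where
    W: "\<not> |W| \<le>o |UNIV :: nat set|" "\<And>a b. a \<in> W \<Longrightarrow> b \<in> W \<Longrightarrow> (a, b) \<in> r \<or> (b, a) \<in> r"
    "trans r" "\<And>a. a \<in> W \<Longrightarrow> |{b \<in> W. (b, a) \<in> r}| \<le>o |UNIV :: nat set|"
    using infinite_successor_order[of "UNIV :: nat set"] by auto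
  have unc: "uncountable W" using W(1) by (simp add: countable_card_of_nat)
  have seg: "countable {b \<in> W. (b, a) \<in> r}" if "a \<in> W" for a
    using W(4)[OF that] by (simp add: countable_card_of_nat)
  have inf: "infinite W" using unc countable_finite by auto
  obtain S :: "nat set set set" and s where
    S: "\<not> |S| \<le>o |W|" "\<And>a b. a \<in> S \<Longrightarrow> b \<in> S \<Longrightarrow> (a, b) \<in> s \<or> (b, a) \<in> s"
    "trans s" "\<And>a. a \<in> S \<Longrightarrow> |{b \<in> S. (b, a) \<in> s}| \<le>o |W|"
    using infinite_successor_order[OF inf] by auto
  have bounded: "\<exists>b\<in>W. \<forall>c\<in>C. (c, b) \<in> r" if C: "countable C" "C \<subseteq> W" for C
  proof (rule ccontr)
    assume *: "\<not> ?thesis"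
    have "W \<subseteq> (\<Union>c\<in>C. {b \<in> W. (b, c) \<in> r})"
    proof
      fix b assume "b \<in> W"
      then obtain c where "c \<in> C" "(c, b) \<notin> r" using * by auto
      then show "b \<in> (\<Union>c\<in>C. {b \<in> W. (b, c) \<in> r})" using W(2)[of b c] C(2) \<open>b \<in> W\<close> by auto
    qed
    moreover have "countable (\<Union>c\<in>C. {b \<in> W. (b, c) \<in> r})"
      using C seg by (intro countable_UN) auto
    ultimately show False using unc countable_subset by auto
  qed
  have "\<exists>f. inj_on f {i \<in> S. (i, j) \<in> s} \<and> f ` {i \<in> S. (i, j) \<in> s} \<subseteq> W" if "j \<in> S" for j
    using S(4)[OF that] card_of_ordLeq[of "{i \<in> S. (i, j) \<in> s}" W] by simp
  then have "\<exists>f. \<forall>j\<in>S. inj_on (f j) {i \<in> S. (i, j) \<in> s} \<and> f j ` {i \<in> S. (i, j) \<in> s} \<subseteq> W"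
    by (intro bchoice) auto
  then obtain f where f: "\<And>j. j \<in> S \<Longrightarrow> inj_on (f j) {i \<in> S. (i, j) \<in> s}"
    "\<And>j. j \<in> S \<Longrightarrow> f j ` {i \<in> S. (i, j) \<in> s} \<subseteq> W"
    by auto
  \<comment> \<open>\<open>w0\<close> is a dummy value of \<open>h\<close> for pairs that are not
    ordered by \<open>s\<close>.\<close>
  obtain w0 where w0: "w0 \<in> W" using inf by fastforce
  define h where "h i j = (if (i, j) \<in> s then f j i else w0)" for i j
  have h_W: "h i j \<in> W" if "i \<in> S" "j \<in> S" for i j
    using f(2)[OF that(2)] w0 that(1) unfolding h_def by auto
  have "coloring W r S h"
  proof
    fix \<alpha> assume \<alpha>: "\<And>i. i \<in> S \<Longrightarrow> \<alpha> i \<in> W"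
    \<comment> \<open>More than \<open>|W|\<close> many indices share one value \<open>a\<close> of
      \<open>\<alpha>\<close>.\<close>
    define P where "P a = {i \<in> S. \<alpha> i = a}" for a
    have "\<exists>a\<in>W. \<not> |P a| \<le>o |W|"
    proof (rule ccontr)
      assume "\<not> ?thesis"
      then have "|\<Union>a\<in>W. P a| \<le>o |W|"
        using inf by (intro card_of_UNION_ordLeq_infinite) (auto intro: card_of_mono1)
      moreover have "S = (\<Union>a\<in>W. P a)" using \<alpha> unfolding P_def by auto
      ultimately show False using S(1) by simp
    qed
    then obtain a where a: "a \<in> W" "\<not> |P a| \<le>o |W|" by auto
    then have "|W| \<le>o |P a|"
      using ordLeq_total[OF card_of_Well_order[of W] card_of_Well_order[of "P a"]] by simp
    then obtain g where g: "inj_on g W" "g ` W \<subseteq> P a" using card_of_ordLeq[of W "P a"] by auto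
    \<comment> \<open>Some \<open>j\<close> in \<open>P a\<close> bounds a copy of \<open>W\<close>
      inside \<open>P a\<close>; otherwise \<open>|W|\<close> many initial segments, each of size at
      most \<open>|W|\<close>, would cover \<open>P a\<close>.\<close>
    have "\<exists>j\<in>P a. \<forall>w\<in>W. (g w, j) \<in> s"
    proof (rule ccontr)
      assume *: "\<not> ?thesis"
      have "P a \<subseteq> (\<Union>w\<in>W. {j \<in> S. (j, g w) \<in> s})"
      proof
        fix j assume j: "j \<in> P a"
        then obtain w where "w \<in> W" "(g w, j) \<notin> s" using * by auto
        then show "j \<in> (\<Union>w\<in>W. {j \<in> S. (j, g w) \<in> s})"
          using S(2)[of j "g w"] j g(2) unfolding P_def by auto
      qed
      moreover have "|\<Union>w\<in>W. {j \<in> S. (j, g w) \<in> s}| \<le>o |W|"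
        using inf S(4) g(2) unfolding P_def by (intro card_of_UNION_ordLeq_infinite) (auto intro: card_of_mono1)
      ultimately have "|P a| \<le>o |W|" by (rule card_of_subset_ordLeq)
      then show False using a(2) by simp
    qed
    then obtain j where j: "j \<in> P a" "\<And>w. w \<in> W \<Longrightarrow> (g w, j) \<in> s" by auto
    then have jS: "j \<in> S" unfolding P_def by auto
    define X where "X = g ` W - {j}"
    have X: "X \<subseteq> {i \<in> S. (i, j) \<in> s}" using g(2) j(2) unfolding X_def P_def by auto
    have "uncountable (g ` W)" using unc countable_image_inj_on[OF _ g(1)] by auto
    then have "uncountable X" unfolding X_def by (simp add: uncountable_minus_countable)
    \<comment> \<open>The injective \<open>f j\<close> takes uncountably many values on
      \<open>X\<close>, of which only countably many are below \<open>a\<close>.\<close>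
    then have "uncountable (f j ` X)"
      using countable_image_inj_on[of "f j" X] inj_on_subset[OF f(1)[OF jS] X] by auto
    then have "\<not> f j ` X \<subseteq> {b \<in> W. (b, a) \<in> r}"
      using countable_subset[OF _ seg[OF a(1)]] by auto
    then obtain i where i: "i \<in> X" "(f j i, a) \<notin> r" using f(2)[OF jS] X by auto
    have "i \<in> S" "i \<noteq> j" "\<alpha> i = a" "\<alpha> j = a" "(i, j) \<in> s"
      using i(1) g(2) j(1) X unfolding X_def P_def by auto
    then show "\<exists>i\<in>S. \<exists>j\<in>S. i \<noteq> j \<and> (h i j, \<alpha> i) \<notin> r \<and> (h i j, \<alpha> j) \<notin> r"
      using i(2) jS unfolding h_def by (intro bexI[of _ i] bexI[of _ j]) auto
  next
    fix T assume T: "T \<subseteq> S" "|T| \<le>o |W|"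
    obtain g where g: "inj_on g T" "g ` T \<subseteq> W" using T(2) card_of_ordLeq[of T W] by auto
    \<comment> \<open>Transporting the order of \<open>W\<close> along \<open>g\<close> leaves each
      \<open>i\<close> in \<open>T\<close> only countably many predecessors \<open>D i\<close>. So
      one \<open>z i\<close> bounds all values of \<open>h\<close> between \<open>i\<close> and
      them, in both argument orders since \<open>h\<close> need not be symmetric.\<close>
    define D where "D i = {k \<in> T. (g k, g i) \<in> r}" for i
    have "countable (D i)" if "i \<in> T" for i
    proof -
      have "g ` D i \<subseteq> {b \<in> W. (b, g i) \<in> r}" using g(2) unfolding D_def by auto
      moreover have "g i \<in> W" using g(2) that by auto
      ultimately have "countable (g ` D i)" by (rule countable_subset[OF _ seg])
      moreover have "inj_on g (D i)" using inj_on_subset[OF g(1)] unfolding D_def by auto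
      ultimately show ?thesis by (rule countable_image_inj_on)
    qed
    then have "\<exists>b\<in>W. \<forall>c \<in> h i ` D i \<union> (\<lambda>k. h k i) ` D i. (c, b) \<in> r" if "i \<in> T" for i
      using that h_W T(1) unfolding D_def by (intro bounded) auto
    then have "\<exists>z. \<forall>i\<in>T. z i \<in> W \<and> (\<forall>c \<in> h i ` D i \<union> (\<lambda>k. h k i) ` D i. (c, z i) \<in> r)"
      by (intro bchoice ballI) (simp only: Bex_def)
    then obtain z where "\<forall>i\<in>T. z i \<in> W \<and> (\<forall>c \<in> h i ` D i \<union> (\<lambda>k. h k i) ` D i. (c, z i) \<in> r)" ..
    then have z: "\<And>i. i \<in> T \<Longrightarrow> z i \<in> W"
      "\<And>i c. i \<in> T \<Longrightarrow> c \<in> h i ` D i \<union> (\<lambda>k. h k i) ` D i \<Longrightarrow> (c, z i) \<in> r"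
      by simp_all
    have "(h i j, z i) \<in> r \<or> (h i j, z j) \<in> r" if "i \<in> T" "j \<in> T" for i j
    proof -
      have "j \<in> D i \<or> i \<in> D j" using W(2)[of "g i" "g j"] g(2) that unfolding D_def by auto
      then show ?thesis using z(2)[OF that(1), of "h i j"] z(2)[OF that(2), of "h i j"] by auto
    qed
    then show "\<exists>z. \<forall>i\<in>T. z i \<in> W \<and> (\<forall>j\<in>T. i \<noteq> j \<longrightarrow> (h i j, z i) \<in> r \<or> (h i j, z j) \<in> r)"
      using z(1) by (intro exI[of _ z]) auto
  qed (use inf W(2,3) bounded in auto)
  then show thesis using that by blast
qed

section \<open>The space of ultrafilters\<close>

text \<open>A point \<open>d\<close> codes a function from \<open>\<omega>\<^sub>2\<close> to \<open>\<omega>\<^sub>1 + 1\<close>, with \<^const>\<open>None\<close> for the top value.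
  Codes that violate the constraint given by \<open>h\<close> are put into the ideal rather than removed.\<close>

locale coloring_space = coloring W r S h
  for W :: "'w set" and r and S :: "'i set" and h +
  fixes y :: "'d \<Rightarrow> 'i \<Rightarrow> 'w option"
  assumes surj_y: "surj y"
begin

definition valid :: "'d \<Rightarrow> bool" where
  "valid d \<longleftrightarrow> (\<forall>i\<in>S. \<forall>a. y d i = Some a \<longrightarrow> a \<in> W) \<and>
    (\<forall>i\<in>S. \<forall>j\<in>S. \<forall>a b. i \<noteq> j \<longrightarrow> y d i = Some a \<longrightarrow> y d j = Some b \<longrightarrow>
      (h i j, a) \<in> r \<or> (h i j, b) \<in> r)"

text \<open>Codes that are not valid belong to every \<open>misses T\<close>;
  \<open>misses {}\<close> consists of exactly these.\<close>

definition misses :: "'i set \<Rightarrow> 'd set" where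
  "misses T = {d. valid d \<longrightarrow> (\<exists>i\<in>T. y d i = None)}"

definition I :: "'d set set" where
  "I = {B. \<exists>T\<subseteq>S. |T| \<le>o |W| \<and> B \<subseteq> misses T}"


sublocale sigma_ideal I
proof
  have "|{} :: 'i set| \<le>o |W|" by (rule card_of_empty)
  then show "{} \<in> I" unfolding I_def by blast
  show "UNIV \<notin> I"
  proof
    assume "UNIV \<in> I"
    then obtain T where T: "T \<subseteq> S" "|T| \<le>o |W|" "UNIV \<subseteq> misses T" unfolding I_def by blast
    obtain z where z: "\<And>i. i \<in> T \<Longrightarrow> z i \<in> W"
      "\<And>i j. i \<in> T \<Longrightarrow> j \<in> T \<Longrightarrow> i \<noteq> j \<Longrightarrow> (h i j, z i) \<in> r \<or> (h i j, z j) \<in> r"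
      using small_solution[OF T(1,2)] by auto
    \<comment> \<open>The value \<open>None\<close> is unconstrained, so a solution on
      \<open>T\<close> extends by \<open>None\<close> to a valid code outside
      \<open>misses T\<close>.\<close>
    obtain d where d: "y d = (\<lambda>i. if i \<in> T then Some (z i) else None)"
      using surjD[OF surj_y] by metis
    have "valid d" unfolding valid_def d using z by (auto split: if_splits)
    moreover have "d \<in> misses T" using T(3) by auto
    ultimately obtain i where "i \<in> T" "y d i = None" unfolding misses_def by auto
    then show False unfolding d by simp
  qed
  show "B \<in> I" if "A \<in> I" "B \<subseteq> A" for A B
    using that unfolding I_def by (blast intro: subset_trans)
  show "(\<Union>n. A n) \<in> I" if A: "\<And>n. A n \<in> I" for A :: "nat \<Rightarrow> 'd set"
  proof -
    have "\<exists>T. \<forall>n. T n \<subseteq> S \<and> |T n| \<le>o |W| \<and> A n \<subseteq> misses (T n)"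
      using A unfolding I_def by (intro choice) blast
    then obtain T where T: "\<And>n. T n \<subseteq> S" "\<And>n. |T n| \<le>o |W|" "\<And>n. A n \<subseteq> misses (T n)" by auto
    have "|UNIV :: nat set| \<le>o |W|" using infinite_W by (simp add: infinite_iff_card_of_nat)
    then have "|\<Union>n. T n| \<le>o |W|"
      using infinite_W T(2) by (intro card_of_UNION_ordLeq_infinite) auto
    moreover have "(\<Union>n. A n) \<subseteq> misses (\<Union>n. T n)"
      using T(3) unfolding misses_def by fastforce
    moreover have "(\<Union>n. T n) \<subseteq> S" using T(1) by auto
    ultimately show ?thesis unfolding I_def by auto
  qed
qed

text \<open>For valid \<open>d\<close>, membership means that \<open>y d i\<close> lies strictly
  above \<open>a\<close>, with \<open>None\<close> above everything.\<close>

definition F :: "'i \<Rightarrow> 'w \<Rightarrow> 'd set" where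
  "F i a = {d. \<forall>b. y d i = Some b \<longrightarrow> (b, a) \<notin> r}"

text \<open>\<open>bounded\<close> gives countable directedness. For empty interior: if each
  \<open>A - F i a\<close> were in \<open>I\<close> by some \<open>T a\<close>, then the union of
  all \<open>T a\<close> together with \<open>i\<close> would still be small enough to put
  \<open>A\<close> into \<open>I\<close>.\<close>

lemma nd_P_set_F:
  assumes "i \<in> S"
  shows "nd_P_set K (\<Inter>a\<in>W. stone (F i a))"
proof (rule nd_P_set_filter)
  fix w :: "nat \<Rightarrow> 'w" assume w: "\<And>n. w n \<in> W"
  then have "countable (range w)" "range w \<subseteq> W" by auto
  then obtain b where "b \<in> W" "\<forall>c\<in>range w. (c, b) \<in> r" using bounded by blast
  moreover from this have "F i b \<subseteq> F i (w n)" for n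
    using trans_r unfolding F_def by (auto dest: transD)
  ultimately show "\<exists>v\<in>W. \<forall>n. F i v \<subseteq> F i (w n)" by auto
next
  fix A assume A: "A \<notin> I"
  show "\<exists>a\<in>W. A - F i a \<notin> I"
  proof (rule ccontr)
    assume "\<not> ?thesis"
    then have "\<exists>T. \<forall>a\<in>W. T a \<subseteq> S \<and> |T a| \<le>o |W| \<and> A - F i a \<subseteq> misses (T a)"
      unfolding I_def by (intro bchoice) blast
    then obtain T where T: "\<And>a. a \<in> W \<Longrightarrow> T a \<subseteq> S" "\<And>a. a \<in> W \<Longrightarrow> |T a| \<le>o |W|"
      "\<And>a. a \<in> W \<Longrightarrow> A - F i a \<subseteq> misses (T a)" by auto
    define R where "R = {i} \<union> (\<Union>a\<in>W. T a)"
    have "|\<Union>a\<in>W. T a| \<le>o |W|"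
      using infinite_W T(2) by (intro card_of_UNION_ordLeq_infinite) (auto intro: card_of_mono1)
    moreover have "|{i}| \<le>o |W|" using infinite_W by (intro card_of_singl_ordLeq) auto
    ultimately have "|R| \<le>o |W|"
      unfolding R_def using infinite_W
      by (intro card_of_Un_ordLeq_infinite_Field) (simp_all add: Field_card_of card_of_card_order_on)
    moreover have "R \<subseteq> S" using assms T(1) unfolding R_def by auto
    moreover have "A \<subseteq> misses R"
    proof
      fix d assume d: "d \<in> A"
      have "\<exists>j\<in>R. y d j = None" if "valid d"
      proof (cases "y d i")
        case None
        then show ?thesis unfolding R_def by auto
      next
        case (Some c)
        then have c: "c \<in> W" using that assms unfolding valid_def by auto
        \<comment> \<open>The value \<open>c\<close> of \<open>y d i\<close> serves as its own
          bound, by reflexivity of \<open>r\<close> on \<open>W\<close>.\<close>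
        then have "d \<notin> F i c" using total[of c c] Some unfolding F_def by auto
        then have "d \<in> misses (T c)" using T(3)[OF c] d by auto
        then show ?thesis using that c unfolding misses_def R_def by auto
      qed
      then show "d \<in> misses R" unfolding misses_def by auto
    qed
    ultimately have "A \<in> I" unfolding I_def by auto
    then show False using A by simp
  qed
qed

text \<open>Otherwise, for every \<open>i\<close>, the ultrafilter bounds \<open>y d i\<close> by
  some \<open>\<alpha> i\<close>. For the pair from \<open>pigeonhole\<close>, these two bounds
  contradict the constraint, so a member of \<open>x\<close> would consist of codes that are not
  valid.\<close>

lemma cover_F:
  assumes "x \<in> ult"
  shows "\<exists>i\<in>S. x \<in> (\<Inter>a\<in>W. stone (F i a))"
proof (rule ccontr)
  assume "\<not> ?thesis"
  then have "\<forall>i\<in>S. \<exists>a. a \<in> W \<and> F i a \<notin> x" using assms unfolding stone_def by auto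
  then obtain \<alpha> where \<alpha>: "\<And>i. i \<in> S \<Longrightarrow> \<alpha> i \<in> W \<and> F i (\<alpha> i) \<notin> x"
    using bchoice[of S "\<lambda>i a. a \<in> W \<and> F i a \<notin> x"] by auto
  then obtain i j where ij: "i \<in> S" "j \<in> S" "i \<noteq> j" "(h i j, \<alpha> i) \<notin> r" "(h i j, \<alpha> j) \<notin> r"
    using pigeonhole[of \<alpha>] by auto
  let ?B = "- F i (\<alpha> i) \<inter> - F j (\<alpha> j)"
  have "?B \<in> x" using \<alpha> ij assms ult_Compl ult_Int by simp
  then have "?B \<notin> I" using ult_pos assms by simp
  moreover have "\<not> valid d" if d: "d \<in> ?B" for d
  proof
    assume v: "valid d"
    obtain a b where "y d i = Some a" "(a, \<alpha> i) \<in> r" "y d j = Some b" "(b, \<alpha> j) \<in> r"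
      using d unfolding F_def by auto
    moreover from this have "(h i j, a) \<in> r \<or> (h i j, b) \<in> r"
      using v ij(1-3) unfolding valid_def by auto
    ultimately show False using ij(4,5) trans_r by (auto dest: transD)
  qed
  then have "?B \<subseteq> misses {}" unfolding misses_def by auto
  then have "?B \<in> I" unfolding I_def using card_of_empty by blast
  ultimately show False by simp
qed

lemma nd_P_covered_K:
  assumes "bij_betw \<phi> T {A. clopenin K A}"
  shows "nd_P_covered K T \<phi>"
proof
  show "compact_space K" "Hausdorff_space K" by (fact compact_K Hausdorff_K)+
  show "topspace K \<noteq> {}"
    using proper stone_eq_empty_iff[of UNIV] unfolding topspace_K stone_UNIV by simp
  show "\<exists>V. clopenin K V \<and> x \<in> V \<and> V \<subseteq> U" if U: "openin K U" "x \<in> U" for U x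
  proof -
    have "\<forall>x\<in>U. \<exists>A. x \<in> stone A \<and> stone A \<subseteq> U"
      using U(1) unfolding openin_K by (rule conjunct2)
    then obtain A where "x \<in> stone A" "stone A \<subseteq> U" using U(2) by auto
    then show ?thesis using clopenin_stone by (intro exI[of _ "stone A"]) auto
  qed
  show "\<exists>Z. nd_P_set K Z \<and> x \<in> Z" if "x \<in> topspace K" for x
    using cover_F[of x] nd_P_set_F that unfolding topspace_K by auto
qed (use assms separation_K in auto)

end


section \<open>Fitting the spaces into the type of points\<close>

lemma ex_inj_partial_functions:
  "\<exists>g :: (nat set set \<Rightarrow> nat set option) \<Rightarrow> nat set set set set. inj g"
proof -
  have "inj (\<lambda>(w :: nat set). {w})" by (auto intro: injI)
  then have "|UNIV :: nat set set| \<le>o |UNIV :: nat set set set|"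
    unfolding card_of_ordLeq[symmetric] by (intro exI[of _ "\<lambda>w. {w}"]) simp
  then have "|(UNIV :: nat set set set) \<times> (UNIV :: nat set set)| =o |UNIV :: nat set set set|"
    by (intro card_of_Times_infinite_simps(1)) (auto simp: Finite_Set.finite_set)
  then obtain p :: "nat set set \<times> nat set \<Rightarrow> nat set set" where p: "inj p"
    using card_of_ordIso[of "(UNIV :: nat set set set) \<times> (UNIV :: nat set set)" "UNIV :: nat set set set"]
    by (auto simp: bij_betw_def)
  \<comment> \<open>A partial function is coded by its graph, with pairs coded by \<open>p\<close>.
    The outer singleton climbs one type level, so that ultrafilters over the codes have type
    \<open>point\<close>.\<close>
  define g where "g f = {p ` {(i, w). f i = Some w}}" for f
  have "inj g"
  proof (rule injI)
    fix f f' assume "g f = g f'"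
    then have "{(i, w). f i = Some w} = {(i, w). f' i = Some w}"
      unfolding g_def using inj_image_eq_iff[OF p] by simp
    then have "f i = Some w \<longleftrightarrow> f' i = Some w" for i w by (auto simp: set_eq_iff)
    then show "f = f'" by (metis not_Some_eq ext)
  qed
  then show ?thesis by blast
qed

theorem theorem1p2:
  shows "\<exists>(E :: point topology) (K :: point topology) (e :: point \<times> point \<Rightarrow> nat).
    tychonoff_space E \<and> topspace E \<noteq> {} \<and> Baire_space E \<and>
    tychonoff_space K \<and> topspace K \<noteq> {} \<and> compact_space K \<and>
    separately_continuous E K two_point e \<and>
    (\<forall>B. B \<in> borel_sets_of (prod_topology E K) \<and> \<not> meager_in (prod_topology E K) B \<longrightarrow>
       \<not> continuous_map (subtopology (prod_topology E K) B) two_point e)"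
proof -
  obtain W :: "nat set set" and r and S :: "nat set set set" and h where "coloring W r S h"
    by (rule coloring_exists)
  then interpret coloring W r S h .
  obtain g :: "(nat set set \<Rightarrow> nat set option) \<Rightarrow> nat set set set set" where "inj g"
    using ex_inj_partial_functions by blast
  then have "surj (inv g)" by (rule inj_imp_surj_inv)
  then interpret X: coloring_space W r S h "inv g" by unfold_locales
  let ?C = "{A. clopenin X.K A}"
  \<comment> \<open>A representative \<open>B\<close> of the clopen set \<open>A\<close> is one type
    level below \<open>point\<close>; its singleton is the point of \<open>E\<close> that names
    \<open>A\<close>.\<close>
  define k :: "point set \<Rightarrow> point" where "k A = {SOME B. A = X.stone B}" for A
  have "inj_on k ?C"
  proof (rule inj_onI)
    have *: "A = X.stone (SOME B. A = X.stone B)" if "A \<in> ?C" for A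
      using that someI_ex[of "\<lambda>B. A = X.stone B"] X.clopenin_iff_stone by simp
    fix A A' assume "A \<in> ?C" "A' \<in> ?C" "k A = k A'"
    then show "A = A'" using *[of A] *[of A'] unfolding k_def by simp
  qed
  then have "bij_betw (inv_into ?C k) (k ` ?C) ?C"
    by (intro bij_betw_inv_into inj_on_imp_bij_betw)
  then interpret Y: nd_P_covered X.K "k ` ?C" "inv_into ?C k"
    by (rule X.nd_P_covered_K)
  have "topspace Y.E \<noteq> {}" unfolding Y.topspace_E using clopenin_simps(1)[of X.K] by auto
  then show ?thesis
    using Y.tychonoff_E Y.Baire_E Y.tychonoff_K Y.nonempty Y.compact Y.separately_continuous_e
      Y.not_continuous_on_nonmeager_borel
    by (intro exI[of _ Y.E] exI[of _ X.K] exI[of _ Y.e]) simp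
qed

end
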